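(* Let $d\ge2$ be an integer, $m>0$ real, $\alpha>\frac{j_{d/2-1,1}}{\pi}$, and let $\mathcal{X}\subseteq[-\frac12,\frac12)^d$ be a finite non-empty set such that $\Delta_2(\mathcal{X})\ge\frac{\alpha}{m}$. Then $$\sigma_{\min}(\mathcal{F}_{B_m,\mathcal{X}})\ge\sqrt{c(\alpha)\,m^d}\quad\text{and}\quad \sigma_{\min}(\Phi_{B_m,\mathcal{X}})\ge\sqrt{c(\alpha)\,m^d}.$$
   Context: $B_m=\{x\in\mathbb{R}^d:|x|_2\le m\}$. For compact $\Omega\subset\mathbb{R}^d$ and $\mathcal{X}=\{x_k\}_{k=1}^s$ (distinct points), $\mathcal{F}_{\Omega,\mathcal{X}}:\mathbb{C}^s\to L^2(\Omega)$ is $(\mathcal{F}_{\Omega,\mathcal{X}}u)(\omega)=\sum_{k=1}^s u_ke^{-2\pi i\omega\cdot x_k}$, and $\Phi_{\Omega,\mathcal{X}}=[e^{-2\pi i\omega\cdot x}]_{\omega\in\Omega\cap\mathbb{Z}^d,\,x\in\mathcal{X}}$. $\sigma_{\min}$ denotes the minimum of $\|\mathcal{F}_{\Omega,\mathcal{X}}u\|_{L^2(\Omega)}$ (respectively $|\Phi_{\Omega,\mathcal{X}}u|_2$) over $u\in\mathbb{C}^s$ with $|u|_2=1$. $J_\nu$ is the Bessel function of the first kind of order $\nu$, and $j_{\nu,k}$ is its $k$-th positive zero. $|\mathbb{S}^{d-1}|$ is the surface measure of the unit sphere in $\mathbb{R}^d$. For $\alpha\in(\frac{j_{d/2-1,1}}{\pi},\frac{j_{d/2,1}}{\pi})$,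 $$c(\alpha)=\frac{1}{|\mathbb{S}^{d-1}|}\Big(\frac{2}{\alpha}\Big)^d\frac{\gamma(\alpha)}{1+\gamma(\alpha)/d},\qquad \gamma(\alpha)=\frac{-\pi\alpha J_{d/2-1}(\pi\alpha)}{J_{d/2}(\pi\alpha)},$$ and for $\alpha\ge\frac{j_{d/2,1}}{\pi}$, $c(\alpha)=\frac{1}{|\mathbb{S}^{d-1}|}\big(\frac{2\pi}{j_{d/2,1}}\big)^d$. The minimum separation is $\Delta_p(\mathcal{X})=\min_{x\ne x'\in\mathcal{X}}|x-x'|_p$ ($+\infty$ if $\mathcal{X}$ is a single point). Convention on metrics: in statements about $\mathcal{F}_{\Omega,\mathcal{X}}$, $|\cdot|_p$ is the usual $\ell^p$ norm on $\mathbb{R}^d$; in statements about $\Phi_{\Omega,\mathcal{X}}$, $\mathcal{X}$ is regarded as a subset of the torus $\mathbb{T}^d=(\mathbb{R}/\mathbb{Z})^d\cong[-\frac12,\frac12)^d$ and $|x|_p$ means $\min_{n\in\mathbb{Z}^d}|x+n|_p$. The hypothesis is read in the metric corresponding to the operator. *)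

theory Defs
  imports "HOL-Analysis.Analysis"
begin

section \<open>Fourier operators and their smallest singular values\<close>

text \<open>A finite node set \<open>X\<close> plays the role of \<open>{x_1, \<dots>, x_s}\<close>; coefficient vectors in \<open>\<complex>^s\<close> are
  functions \<open>u\<close> on nodes, of which only the values on \<open>X\<close> matter.\<close>

definition char_exp :: "real ^ 'n \<Rightarrow> real ^ 'n \<Rightarrow> complex" where
  "char_exp \<omega> x = exp (- 2 * of_real pi * \<i> * of_real (\<omega> \<bullet> x))"

definition fourier_sum :: "(real ^ 'n) set \<Rightarrow> (real ^ 'n \<Rightarrow> complex) \<Rightarrow> real ^ 'n \<Rightarrow> complex" where
  "fourier_sum X u \<omega> = (\<Sum>x\<in>X. u x * char_exp \<omega> x)"

definition L2_norm_on :: "(real ^ 'n) set \<Rightarrow> (real ^ 'n \<Rightarrow> complex) \<Rightarrow> real" where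
  "L2_norm_on \<Omega> f = sqrt (LINT \<omega>:\<Omega>|lborel. (cmod (f \<omega>))\<^sup>2)"

definition int_lattice :: "(real ^ 'n) set" where
  "int_lattice = {\<omega>. \<forall>i. \<omega> $ i \<in> \<int>}"

text \<open>The matrix-vector product of \<open>\<Phi>\<close>, whose rows are indexed by the integer points of \<open>\<Omega>\<close>, with \<open>u\<close>
  is \<^term>\<open>fourier_sum X u\<close> restricted to those points.\<close>

definition unit_coeffs :: "'a set \<Rightarrow> ('a \<Rightarrow> complex) set" where
  "unit_coeffs X = {u. L2_set (\<lambda>x. cmod (u x)) X = 1}"

text \<open>Both infima below are attained for compact \<open>\<Omega>\<close> and finite non-empty \<open>X\<close>; see
  \<open>sigma_min_F_attained\<close> and \<open>sigma_min_Phi_attained\<close>.\<close>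

definition sigma_min_F :: "(real ^ 'n) set \<Rightarrow> (real ^ 'n) set \<Rightarrow> real" where
  "sigma_min_F \<Omega> X = (INF u\<in>unit_coeffs X. L2_norm_on \<Omega> (fourier_sum X u))"

definition sigma_min_Phi :: "(real ^ 'n) set \<Rightarrow> (real ^ 'n) set \<Rightarrow> real" where
  "sigma_min_Phi \<Omega> X =
     (INF u\<in>unit_coeffs X. L2_set (\<lambda>\<omega>. cmod (fourier_sum X u \<omega>)) (\<Omega> \<inter> int_lattice))"


section \<open>Minimum separation\<close>

definition torus_norm :: "real ^ 'n \<Rightarrow> real" where
  "torus_norm x = (INF n\<in>int_lattice. norm (x + n))"

definition min_separation :: "('a::ab_group_add \<Rightarrow> real) \<Rightarrow> 'a set \<Rightarrow> ereal" where
  "min_separation N X = (INF (x, x') \<in> {(x, x'). x \<in> X \<and> x' \<in> X \<and> x \<noteq> x'}. ereal (N (x - x')))"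


section \<open>Bessel functions and the constant\<close>

text \<open>The value at \<open>x = 0\<close> is that of \<open>J\<^sub>\<nu>\<close> only for \<open>\<nu> > 0\<close>, since \<open>0 powr 0 = 0\<close>; the function is
  intended for \<open>x > 0\<close>.\<close>

definition Bessel_J :: "real \<Rightarrow> real \<Rightarrow> real" where
  "Bessel_J \<nu> x =
     (\<Sum>k. (-1) ^ k / fact k * rGamma (of_nat k + \<nu> + 1) * (x / 2) powr (2 * of_nat k + \<nu>))"

text \<open>The \<open>k\<close>-th positive zero, for \<open>k \<ge> 1\<close>; a positive cardinality also forces the set to be finite.\<close>

definition Bessel_zero :: "real \<Rightarrow> nat \<Rightarrow> real" where
  "Bessel_zero \<nu> k =
     (THE x. x > 0 \<and> Bessel_J \<nu> x = 0 \<and> card {y. 0 < y \<and> y \<le> x \<and> Bessel_J \<nu> y = 0} = k)"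

text \<open>Surface measure of a subset \<open>A\<close> of the unit sphere: the dimension times the volume of the
  cone over \<open>A\<close>, which is the measure in the polar coordinates formula.\<close>

definition sphere_measure :: "(real ^ 'n) set \<Rightarrow> real" where
  "sphere_measure A = real CARD('n) * measure lebesgue {r *\<^sub>R x | r x. 0 < r \<and> r \<le> 1 \<and> x \<in> A}"

definition gamma_const :: "nat \<Rightarrow> real \<Rightarrow> real" where
  "gamma_const d \<alpha> =
     - pi * \<alpha> * Bessel_J (real d / 2 - 1) (pi * \<alpha>) / Bessel_J (real d / 2) (pi * \<alpha>)"

text \<open>Only meaningful for \<open>\<alpha> > Bessel_zero (d / 2 - 1) 1 / pi\<close>, where \<open>d = CARD('n)\<close>.\<close>

definition c_const :: "'n::finite itself \<Rightarrow> real \<Rightarrow> real" where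
  "c_const _ \<alpha> =
     (let d = CARD('n); S = sphere_measure (sphere (0 :: real ^ 'n) 1);
          j = Bessel_zero (real d / 2) 1
      in if \<alpha> < j / pi
         then 1 / S * (2 / \<alpha>) ^ d * (gamma_const d \<alpha> / (1 + gamma_const d \<alpha> / real d))
         else 1 / S * (2 * pi / j) ^ d)"


section \<open>The smallest singular values are minima\<close>

lemma compact_unit_coeffs:
  assumes "finite X"
  shows "compact (unit_coeffs X \<inter> {u. \<forall>x. x \<notin> X \<longrightarrow> u x = 0})"
proof -
  define K :: "('a \<Rightarrow> complex) set" where
    "K = PiE UNIV (\<lambda>x. if x \<in> X then cball 0 1 else {0})"
  have "compactin (product_topology (\<lambda>_. euclidean) UNIV) K"
    unfolding K_def by (subst compactin_PiE) (auto simp: compactin_euclidean_iff)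
  then have K: "compact K"
    by (simp add: euclidean_product_topology compactin_euclidean_iff)
  have closed: "closed (unit_coeffs X \<inter> {u. \<forall>x. x \<notin> X \<longrightarrow> u x = 0})"
  proof -
    have "closed (unit_coeffs X)"
      unfolding unit_coeffs_def L2_set_def
      by (intro closed_Collect_eq continuous_intros continuous_on_product_coordinates)
    moreover have "closed {u :: 'a \<Rightarrow> complex. \<forall>x. x \<notin> X \<longrightarrow> u x = 0}"
      unfolding imp_conv_disj
      by (intro closed_Collect_all closed_Collect_disj closed_Collect_const closed_Collect_eq
          continuous_intros continuous_on_product_coordinates)
    ultimately show ?thesis by (rule closed_Int)
  qed
  have "unit_coeffs X \<inter> {u. \<forall>x. x \<notin> X \<longrightarrow> u x = 0} \<subseteq> K"
  proof
    fix u assume u: "u \<in> unit_coeffs X \<inter> {u. \<forall>x. x \<notin> X \<longrightarrow> u x = 0}"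
    have "cmod (u x) \<le> 1" if "x \<in> X" for x
      using member_le_L2_set[OF assms that, of "\<lambda>x. cmod (u x)"] u by (simp add: unit_coeffs_def)
    with u show "u \<in> K" by (auto simp: K_def PiE_def)
  qed
  then show ?thesis
    using compact_Int_closed[OF K closed] by (simp only: inf_absorb2)
qed

lemma unit_coeffs_INF_attained:
  fixes f :: "('a \<Rightarrow> complex) \<Rightarrow> real"
  assumes X: "finite X" "X \<noteq> {}" and cont: "continuous_on UNIV f"
    and loc: "\<And>u v. (\<And>x. x \<in> X \<Longrightarrow> u x = v x) \<Longrightarrow> f u = f v"
  shows "\<exists>u\<in>unit_coeffs X. f u = (INF w\<in>unit_coeffs X. f w) \<and>
    (\<forall>v\<in>unit_coeffs X. (INF w\<in>unit_coeffs X. f w) \<le> f v)"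
proof -
  define K :: "('a \<Rightarrow> complex) set" where
    "K = unit_coeffs X \<inter> {u. \<forall>x. x \<notin> X \<longrightarrow> u x = 0}"
  obtain a where a: "a \<in> X" using X by auto
  have "L2_set (\<lambda>x. cmod (if x = a then 1 else 0)) X = 1"
    using X a by (simp add: L2_set_def if_distrib[of cmod] if_distrib[of "\<lambda>x. x ^ 2"] sum.delta
        cong: if_cong)
  then have "(\<lambda>x. if x = a then 1 else 0) \<in> K"
    using a by (auto simp: K_def unit_coeffs_def)
  then have "K \<noteq> {}" by blast
  with compact_unit_coeffs[OF X(1)] cont obtain u where u: "u \<in> K" "\<And>v. v \<in> K \<Longrightarrow> f u \<le> f v"
    using continuous_attains_inf[of K f] continuous_on_subset unfolding K_def by blast
  have le: "f u \<le> f v" if v: "v \<in> unit_coeffs X" for v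
  proof -
    define w where "w = (\<lambda>x. if x \<in> X then v x else 0)"
    have "L2_set (\<lambda>x. cmod (w x)) X = L2_set (\<lambda>x. cmod (v x)) X"
      by (rule L2_set_cong) (auto simp: w_def)
    with v have "w \<in> K" by (auto simp: K_def unit_coeffs_def w_def)
    moreover have "f w = f v" by (rule loc) (simp add: w_def)
    ultimately show ?thesis using u(2) by fastforce
  qed
  have eq: "(INF w\<in>unit_coeffs X. f w) = f u"
    by (rule cInf_eq_minimum) (use u le in \<open>auto simp: K_def\<close>)
  show ?thesis unfolding eq using u le by (auto simp: K_def)
qed

lemma fourier_sum_cong:
  "(\<And>x. x \<in> X \<Longrightarrow> u x = v x) \<Longrightarrow> fourier_sum X u = fourier_sum X v"
  by (auto simp: fourier_sum_def fun_eq_iff intro!: sum.cong)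

lemma continuous_fourier_sum: "continuous_on UNIV (\<lambda>u. fourier_sum X u \<omega>)"
  unfolding fourier_sum_def
  by (intro continuous_intros continuous_on_product_coordinates)

lemma sigma_min_Phi_attained:
  assumes "finite X" "X \<noteq> {}"
  shows "\<exists>u\<in>unit_coeffs X.
    L2_set (\<lambda>\<omega>. cmod (fourier_sum X u \<omega>)) (\<Omega> \<inter> int_lattice) = sigma_min_Phi \<Omega> X \<and>
    (\<forall>v\<in>unit_coeffs X. sigma_min_Phi \<Omega> X \<le> L2_set (\<lambda>\<omega>. cmod (fourier_sum X v \<omega>)) (\<Omega> \<inter> int_lattice))"
proof -
  have cont: "continuous_on UNIV
      (\<lambda>u. L2_set (\<lambda>\<omega>. cmod (fourier_sum X u \<omega>)) (\<Omega> \<inter> int_lattice))"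
    unfolding L2_set_def by (intro continuous_intros continuous_fourier_sum)
  have loc: "L2_set (\<lambda>\<omega>. cmod (fourier_sum X u \<omega>)) (\<Omega> \<inter> int_lattice) =
      L2_set (\<lambda>\<omega>. cmod (fourier_sum X v \<omega>)) (\<Omega> \<inter> int_lattice)"
    if "\<And>x. x \<in> X \<Longrightarrow> u x = v x" for u v
    using fourier_sum_cong[of X u v, OF that] by simp
  show ?thesis
    unfolding sigma_min_Phi_def by (rule unit_coeffs_INF_attained[OF assms cont loc])
qed

lemma L2_norm_on_fourier_sum:
  fixes X :: "(real ^ 'n) set"
  assumes "compact \<Omega>"
  shows "L2_norm_on \<Omega> (fourier_sum X u) =
    sqrt (Re (\<Sum>x\<in>X. \<Sum>y\<in>X. u x * cnj (u y) * (LINT \<omega>:\<Omega>|lborel. char_exp \<omega> x * cnj (char_exp \<omega> y))))"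
proof -
  have int: "set_integrable lborel \<Omega> (\<lambda>\<omega>. u x * cnj (u y) * (char_exp \<omega> x * cnj (char_exp \<omega> y)))" for x y
    unfolding set_integrable_def char_exp_def
    by (rule borel_integrable_compact[OF assms]) (intro continuous_intros)
  have sq: "of_real ((cmod (fourier_sum X u \<omega>))\<^sup>2) =
      (\<Sum>x\<in>X. \<Sum>y\<in>X. u x * cnj (u y) * (char_exp \<omega> x * cnj (char_exp \<omega> y)))" for \<omega>
    unfolding complex_norm_square fourier_sum_def cnj_sum sum_product
    by (simp add: algebra_simps)
  have "of_real (LINT \<omega>:\<Omega>|lborel. (cmod (fourier_sum X u \<omega>))\<^sup>2) =
      (LINT \<omega>:\<Omega>|lborel. complex_of_real ((cmod (fourier_sum X u \<omega>))\<^sup>2))"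
    by (rule set_integral_complex_of_real[symmetric])
  also have "\<dots> = (\<Sum>x\<in>X. \<Sum>y\<in>X. (LINT \<omega>:\<Omega>|lborel. u x * cnj (u y) * (char_exp \<omega> x * cnj (char_exp \<omega> y))))"
    unfolding sq set_lebesgue_integral_def scaleR_sum_right
    using int by (simp add: Bochner_Integration.integral_sum set_integrable_def)
  also have "\<dots> = (\<Sum>x\<in>X. \<Sum>y\<in>X. u x * cnj (u y) * (LINT \<omega>:\<Omega>|lborel. char_exp \<omega> x * cnj (char_exp \<omega> y)))"
    by (simp only: set_integral_mult_right)
  finally show ?thesis
    unfolding L2_norm_on_def by (metis Re_complex_of_real)
qed

lemma sigma_min_F_attained:
  assumes "compact \<Omega>" "finite X" "X \<noteq> {}"
  shows "\<exists>u\<in>unit_coeffs X. L2_norm_on \<Omega> (fourier_sum X u) = sigma_min_F \<Omega> X \<and>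
    (\<forall>v\<in>unit_coeffs X. sigma_min_F \<Omega> X \<le> L2_norm_on \<Omega> (fourier_sum X v))"
proof -
  have cont: "continuous_on UNIV (\<lambda>u. L2_norm_on \<Omega> (fourier_sum X u))"
    unfolding L2_norm_on_fourier_sum[OF assms(1)]
    by (intro continuous_intros continuous_on_product_coordinates)
  have loc: "L2_norm_on \<Omega> (fourier_sum X u) = L2_norm_on \<Omega> (fourier_sum X v)"
    if "\<And>x. x \<in> X \<Longrightarrow> u x = v x" for u v
    using fourier_sum_cong[of X u v, OF that] by simp
  show ?thesis
    unfolding sigma_min_F_def by (rule unit_coeffs_INF_attained[OF assms(2,3) cont loc])
qed

end

theory Submission
  imports Defs
begin

text \<open>Let \<open>\<nu> = d / 2 - 1\<close> and suppose first that \<open>pi \<alpha>\<close> is at most the first zero of \<open>J\<^sub>\<nu>\<^sub>+\<^sub>1\<close>. Let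
  \<open>R = \<alpha> / (2 m)\<close>, and let \<open>h\<close> be the radial function on the ball of radius
  \<open>R\<close> that solves \<open>h + \<kappa> \<Delta>h = 1\<close> with \<open>\<kappa> = 1 / (4 pi\<^sup>2 m\<^sup>2)\<close> and vanishes on the boundary, extended by
  \<open>0\<close>. Up to a constant, \<open>h - 1\<close> is \<open>J\<^sub>\<nu>(2 pi m r) / r\<^sup>\<nu>\<close>. The hypothesis on \<open>\<alpha>\<close> makes this Bessel
  function negative at \<open>r = R\<close>, and below the first zero of \<open>J\<^sub>\<nu>\<^sub>+\<^sub>1\<close> the function \<open>h\<close> decreases in \<open>r\<close>;
  hence \<open>h \<ge> 0\<close>. Since the normal derivative of \<open>h\<close> jumps upwards across the sphere, the
  distribution \<open>h + \<kappa> \<Delta>h\<close> is at least the indicator of the ball.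

  The Fourier transform of \<open>h + \<kappa> \<Delta>h\<close> is \<open>1 - |\<omega>|\<^sup>2 / m\<^sup>2\<close> times that of \<open>h\<close>, so
  \<open>(1 - |\<omega>|\<^sup>2 / m\<^sup>2) |hhat \<omega>|\<^sup>2\<close> is at most \<open>0\<close> outside the ball of radius \<open>m\<close>, and at most
  \<open>(hhat 0)\<^sup>2 = (\<integral>h)\<^sup>2\<close> inside because \<open>h \<ge> 0\<close>. Sum this weight against \<open>|f|\<^sup>2\<close>, where
  \<open>f \<omega> = (\<Sum>x. u x * char_exp \<omega> x)\<close>. By Parseval the sum is the pairing of \<open>\<Sum>x. u x h(\<cdot> - x)\<close> with
  \<open>\<Sum>x. u x (h + \<kappa> \<Delta>h)(\<cdot> - x)\<close>. Separation makes the supports of different translates disjoint, so that only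
  diagonal terms remain, and each of them is at least \<open>|u x|\<^sup>2 \<integral>h\<close>. Therefore
  \<open>\<integral>h\<close> times the sum of \<open>|f|\<^sup>2\<close> over the ball is at least \<open>\<Sum>x. |u x|\<^sup>2\<close>, and \<open>1 / \<integral>h\<close> is \<open>c(\<alpha>) m\<^sup>d\<close>.

  On the torus a ball of radius \<open>R > 1 / 2\<close> meets its own integer translates. This does no harm: the
  extra diagonal terms pair \<open>h \<ge> 0\<close> with a translate of \<open>h + \<kappa> \<Delta>h \<ge> 0\<close> and are nonnegative.

  The argument is carried out on the finite grid of mesh \<open>1 / N\<close> in the torus and then \<open>N\<close> tends to
  infinity. On the grid Parseval is the orthogonality of finitely many characters, the Laplacian is a second
  difference whose symbol is explicit, summation by parts is exact, and the lower bound for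
  \<open>h + \<kappa> \<Delta>h\<close> is a pointwise statement up to \<open>O(1/N)\<close> (lemmas \<open>discrete_inequality\<close> and
  \<open>ball_profile_laplacian\<close>). Integrals enter only as limits of Riemann sums (lemma
  \<open>riemann_sum_tendsto\<close>). Rounding the nodes to the grid costs a little separation, which is regained by
  letting the radius increase to \<open>R\<close>. For larger \<open>\<alpha>\<close> the profile that belongs to the first zero of
  \<open>J\<^sub>\<nu>\<^sub>+\<^sub>1\<close> is used (lemma \<open>lattice_sum_ge_c_const\<close>). This gives the bound for \<open>\<Phi>\<close>.

  The bound for \<open>\<F>\<close> follows from the one on the lattice: dilate the nodes by \<open>1 / N\<close> and the ball by \<open>N\<close>.
  For large \<open>N\<close> the torus metric no longer matters, both sides scale by \<open>N\<^sup>d\<close>, and the normalized lattice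
  sums are Riemann sums of the integral of \<open>|f|\<^sup>2\<close> over the ball.\<close>

section \<open>Bessel functions through the Bessel-Clifford series\<close>

text \<open>The Bessel-Clifford function at \<open>- t\<close>: the entire function with
  \<open>J\<^sub>\<nu>(x) = (x / 2)\<^sup>\<nu> clifford \<nu> (x\<^sup>2 / 4)\<close>. In the variable \<open>t\<close> differentiation shifts the order, the Bessel
  equation is a three-term recurrence, and radial functions of \<open>y\<close> become smooth functions of \<open>|y|\<^sup>2\<close>.
  Below, \<open>f\<^sub>\<nu>\<close> stands for \<open>clifford \<nu>\<close>.\<close>

definition clifford :: "real \<Rightarrow> real \<Rightarrow> real" where
  "clifford \<nu> t = (\<Sum>k. (-1) ^ k / fact k * rGamma (of_nat k + \<nu> + 1) * t ^ k)"

lemma rGamma_shift_bounds: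
  assumes "\<nu> \<ge> 0"
  shows "0 < rGamma (of_nat k + \<nu> + 1 :: real)" "rGamma (of_nat k + \<nu> + 1 :: real) \<le> rGamma (\<nu> + 1)"
proof -
  show pos: "0 < rGamma (of_nat k + \<nu> + 1 :: real)" for k
    using assms Gamma_real_pos[of "of_nat k + \<nu> + 1"] by (simp add: rGamma_inverse_Gamma)
  show "rGamma (of_nat k + \<nu> + 1 :: real) \<le> rGamma (\<nu> + 1)"
  proof (induction k)
    case (Suc k)
    have "rGamma (of_nat (Suc k) + \<nu> + 1) \<le> (of_nat k + \<nu> + 1) * rGamma (of_nat k + \<nu> + 1 + 1)"
      using pos[of "Suc k"] assms by (simp add: add_ac mult_le_cancel_right1)
    also have "\<dots> = rGamma (of_nat k + \<nu> + 1)"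
      by (rule rGamma_plus1)
    finally show ?case using Suc by simp
  qed simp
qed

lemma summable_clifford:
  assumes "\<nu> \<ge> 0"
  shows "summable (\<lambda>k. (-1) ^ k / fact k * rGamma (of_nat k + \<nu> + 1) * (t::real) ^ k)"
proof (rule summable_comparison_test)
  have "summable (\<lambda>k. rGamma (\<nu> + 1) * (\<bar>t\<bar> ^ k / fact k))"
    using summable_exp[of "\<bar>t\<bar>"] by (intro summable_mult) (simp add: field_simps)
  then show "summable (\<lambda>k. rGamma (\<nu> + 1) * (\<bar>t\<bar> ^ k / fact k))" .
  show "\<exists>N. \<forall>k\<ge>N. norm ((-1) ^ k / fact k * rGamma (of_nat k + \<nu> + 1) * t ^ k)
      \<le> rGamma (\<nu> + 1) * (\<bar>t\<bar> ^ k / fact k)"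
  proof (intro exI[of _ 0] allI impI)
    fix k
    have "norm ((-1) ^ k / fact k * rGamma (of_nat k + \<nu> + 1) * t ^ k)
        = rGamma (of_nat k + \<nu> + 1) * (\<bar>t\<bar> ^ k / fact k)"
      using rGamma_shift_bounds(1)[OF assms, of k] by (simp add: abs_mult power_abs)
    also have "\<dots> \<le> rGamma (\<nu> + 1) * (\<bar>t\<bar> ^ k / fact k)"
      by (intro mult_right_mono rGamma_shift_bounds assms) simp
    finally show "norm ((-1) ^ k / fact k * rGamma (of_nat k + \<nu> + 1) * t ^ k)
      \<le> rGamma (\<nu> + 1) * (\<bar>t\<bar> ^ k / fact k)" .
  qed
qed

lemma clifford_0: "clifford \<nu> 0 = rGamma (\<nu> + 1)"
  using powser_zero[of "\<lambda>k. (-1) ^ k / fact k * rGamma (of_nat k + \<nu> + 1)"]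
  by (simp add: clifford_def)

lemma clifford_0_pos: "\<nu> \<ge> 0 \<Longrightarrow> clifford \<nu> 0 > 0"
  using rGamma_shift_bounds(1)[of \<nu> 0] by (simp add: clifford_0)

lemma has_real_derivative_clifford:
  assumes "\<nu> \<ge> 0"
  shows "(clifford \<nu> has_real_derivative - clifford (\<nu> + 1) t) (at t)"
proof -
  define c where "c k = (-1) ^ k / fact k * rGamma (of_nat k + \<nu> + 1)" for k :: nat
  have d: "diffs c k = - ((-1) ^ k / fact k * rGamma (of_nat k + (\<nu> + 1) + 1))" for k
  proof -
    have "of_nat (Suc k) * ((-1) ^ Suc k / fact (Suc k)) = - ((-1) ^ k / fact k :: real)"
      by (simp add: fact_Suc field_simps del: of_nat_Suc)
    moreover have "of_nat (Suc k) + \<nu> + 1 = of_nat k + (\<nu> + 1) + 1" by simp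
    ultimately show ?thesis
      unfolding diffs_def c_def by (metis mult.assoc mult_minus_left)
  qed
  have "((\<lambda>x. \<Sum>n. c n * x ^ n) has_real_derivative (\<Sum>n. diffs c n * t ^ n)) (at t)"
    by (rule termdiffs_strong_converges_everywhere)
      (use summable_clifford[OF assms] in \<open>simp add: c_def\<close>)
  also have "(\<Sum>n. diffs c n * t ^ n) = - clifford (\<nu> + 1) t"
    unfolding d clifford_def mult_minus_left using assms
    by (intro suminf_minus summable_clifford) simp
  finally show ?thesis by (simp add: clifford_def[abs_def] c_def)
qed

lemma continuous_on_clifford [continuous_intros]:
  "\<nu> \<ge> 0 \<Longrightarrow> continuous_on A g \<Longrightarrow> continuous_on A (\<lambda>x. clifford \<nu> (g x))"
  using continuous_on_compose2[of UNIV "clifford \<nu>" A g]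
    DERIV_continuous_on[of UNIV "clifford \<nu>"] has_real_derivative_clifford
  by (metis UNIV_I has_field_derivative_at_within subset_UNIV)

text \<open>Coefficientwise this is \<open>rGamma z = z rGamma (z + 1)\<close>. With the derivative rule it says
  \<open>t f'' + (\<nu> + 1) f' + f = 0\<close>, which is Bessel's equation.\<close>

lemma clifford_rec:
  assumes "\<nu> \<ge> 0"
  shows "clifford \<nu> t = (\<nu> + 1) * clifford (\<nu> + 1) t - t * clifford (\<nu> + 2) t"
proof -
  define c where "c \<mu> k = (-1) ^ k / fact k * rGamma (of_nat k + \<mu> + 1)" for \<mu> :: real and k :: nat
  have S: "(\<lambda>k. c \<mu> k * t ^ k) sums clifford \<mu> t" if "\<mu> \<ge> 0" for \<mu>
    using summable_clifford[OF that, of t] by (simp add: c_def clifford_def summable_sums)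
  have "(\<lambda>k. t * (c (\<nu> + 2) k * t ^ k)) sums (t * clifford (\<nu> + 2) t)"
    using assms by (intro sums_mult S) simp
  moreover have "t * (c (\<nu> + 2) k * t ^ k) = - (of_nat (Suc k) * c (\<nu> + 1) (Suc k) * t ^ Suc k)" for k
    by (simp add: c_def fact_Suc field_simps add_ac del: of_nat_Suc) (simp add: add_ac)
  ultimately have "(\<lambda>k. - (of_nat (Suc k) * c (\<nu> + 1) (Suc k) * t ^ Suc k)) sums (t * clifford (\<nu> + 2) t)"
    by simp
  from sums_minus[OF this] have "(\<lambda>k. of_nat (Suc k) * c (\<nu> + 1) (Suc k) * t ^ Suc k) sums - (t * clifford (\<nu> + 2) t)"
    by simp
  then have 1: "(\<lambda>k. of_nat k * c (\<nu> + 1) k * t ^ k) sums - (t * clifford (\<nu> + 2) t)"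
    by (subst (asm) sums_Suc_iff) simp
  have 2: "(\<lambda>k. (\<nu> + 1) * (c (\<nu> + 1) k * t ^ k)) sums ((\<nu> + 1) * clifford (\<nu> + 1) t)"
    using assms by (intro sums_mult S) simp
  have "of_nat k * c (\<nu> + 1) k * t ^ k + (\<nu> + 1) * (c (\<nu> + 1) k * t ^ k) = c \<nu> k * t ^ k" for k
  proof -
    have "c \<nu> k = (of_nat k + \<nu> + 1) * c (\<nu> + 1) k"
      unfolding c_def rGamma_plus1[of "of_nat k + \<nu> + 1", symmetric]
      by (simp only: mult_ac add_ac)
    then show ?thesis by (simp add: algebra_simps)
  qed
  with sums_add[OF 1 2] have "(\<lambda>k. c \<nu> k * t ^ k) sums (- (t * clifford (\<nu> + 2) t) + (\<nu> + 1) * clifford (\<nu> + 1) t)"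
    by simp
  from sums_unique2[OF this S[OF assms]] show ?thesis by simp
qed

lemma Bessel_J_eq_clifford:
  assumes "x > 0" "\<nu> \<ge> 0"
  shows "Bessel_J \<nu> x = (x / 2) powr \<nu> * clifford \<nu> (x\<^sup>2 / 4)"
proof -
  have "(x / 2) powr (2 * of_nat k + \<nu>) = (x / 2) powr \<nu> * (x\<^sup>2 / 4) ^ k" for k
  proof -
    have "(x / 2) powr (2 * of_nat k) = (x / 2) ^ (2 * k)"
      using assms by (subst powr_realpow[symmetric]) auto
    also have "\<dots> = (x\<^sup>2 / 4) ^ k" by (simp add: power_mult power_divide)
    finally show ?thesis by (simp add: powr_add)
  qed
  then show ?thesis
    unfolding Bessel_J_def clifford_def suminf_mult[OF summable_clifford[OF assms(2)], symmetric]
    by (intro suminf_cong) (simp only: mult_ac)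
qed

lemma clifford_pos_of_no_zero:
  assumes "\<mu> \<ge> 0" "\<And>s. 0 < s \<Longrightarrow> s \<le> t \<Longrightarrow> clifford \<mu> s \<noteq> 0" "t \<ge> 0"
  shows "clifford \<mu> t > 0"
proof (rule ccontr)
  assume "\<not> clifford \<mu> t > 0"
  with assms have "\<exists>s\<ge>0. s \<le> t \<and> clifford \<mu> s = 0"
    using clifford_0_pos[OF assms(1)]
    by (intro IVT2') (auto intro!: continuous_on_clifford continuous_on_id)
  then show False using assms(2) clifford_0_pos[OF assms(1)] by (metis less_eq_real_def less_irrefl)
qed

text \<open>Bessel's equation in the form \<open>(t\<^sup>\<mu>\<^sup>+\<^sup>1 f')' = - t\<^sup>\<mu> f\<close> is tested against \<open>w t = (T - t)\<^sup>2\<close>, which has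
  a double zero at \<open>T\<close>. The boundary terms of Green's identity vanish at \<open>0\<close> and \<open>T\<close>, while its integrand
  is \<open>f\<close> times \<open>t\<^sup>\<mu> ((T - t - (\<mu> + 2))\<^sup>2 + 2 T - (\<mu> + 2)\<^sup>2)\<close>. This weight is positive as soon as \<open>2 T > (\<mu> + 2)\<^sup>2\<close>,
  so \<open>f\<close> cannot stay positive.\<close>

lemma clifford_has_zero:
  assumes "\<mu> \<ge> 0"
  shows "\<exists>t>0. clifford \<mu> t = 0"
proof (rule ccontr)
  assume no: "\<not> (\<exists>t>0. clifford \<mu> t = 0)"
  have pos: "clifford \<mu> t > 0" if "t > 0" for t
    using clifford_pos_of_no_zero[OF assms, of t] no that by auto
  define T where "T = (\<mu> + 2)\<^sup>2"
  have T: "T > 0" using assms by (simp add: T_def)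
  \<comment> \<open>\<open>\<Psi> = t\<^sup>\<mu>\<^sup>+\<^sup>1 (f' w - f w')\<close>, and \<open>\<psi>\<close> is its derivative.\<close>
  define \<Psi> where "\<Psi> t = t powr (\<mu> + 1) * (- clifford (\<mu> + 1) t * (T - t)\<^sup>2 + 2 * clifford \<mu> t * (T - t))" for t
  define \<psi> where "\<psi> z = - (z powr \<mu> * clifford \<mu> z * ((T - z - (\<mu> + 2))\<^sup>2 + T))" for z
  have "(\<Psi> has_real_derivative \<psi> z) (at z)" if z: "0 < z" "z < T" for z
  proof -
    have "clifford \<mu> z = (\<mu> + 1) * clifford (\<mu> + 1) z - z * clifford (\<mu> + 2) z"
      by (rule clifford_rec[OF assms])
    then have rec: "z * clifford (\<mu> + 2) z = (\<mu> + 1) * clifford (\<mu> + 1) z - clifford \<mu> z" by simp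
    have d1: "(clifford (\<mu> + 1) has_real_derivative - clifford (\<mu> + 2) z) (at z)"
      using has_real_derivative_clifford[of "\<mu> + 1" z] assms by (simp add: add.assoc)
    have pw: "z powr (\<mu> + 1) = z powr \<mu> * z" using z by (simp add: powr_add)
    define D where "D = (\<mu> + 1) * z powr \<mu> * (- clifford (\<mu> + 1) z * (T - z)\<^sup>2 + 2 * clifford \<mu> z * (T - z)) +
      (clifford (\<mu> + 2) z * (T - z)\<^sup>2 + clifford (\<mu> + 1) z * (2 * (T - z)) -
       2 * clifford (\<mu> + 1) z * (T - z) - 2 * clifford \<mu> z) * z powr (\<mu> + 1)"
    have dpw: "((\<lambda>z. z powr (\<mu> + 1)) has_real_derivative (\<mu> + 1) * z powr \<mu>) (at z)"
      using has_real_derivative_powr[OF z(1), of "\<mu> + 1"] by simp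
    have dw: "((\<lambda>z. - clifford (\<mu> + 1) z * (T - z)\<^sup>2 + 2 * clifford \<mu> z * (T - z)) has_real_derivative
      clifford (\<mu> + 2) z * (T - z)\<^sup>2 + clifford (\<mu> + 1) z * (2 * (T - z)) -
       2 * clifford (\<mu> + 1) z * (T - z) - 2 * clifford \<mu> z) (at z)"
      by (rule derivative_eq_intros has_real_derivative_clifford[OF assms] d1 refl)+ (simp add: algebra_simps)
    have "(\<Psi> has_real_derivative D) (at z)"
      unfolding \<Psi>_def D_def by (rule DERIV_mult[OF dpw dw])
    also have "D = z powr \<mu> * ((\<mu> + 1) * (- clifford (\<mu> + 1) z * (T - z)\<^sup>2 + 2 * clifford \<mu> z * (T - z))
        + (z * clifford (\<mu> + 2) z) * (T - z)\<^sup>2 - 2 * z * clifford \<mu> z)"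
      unfolding D_def pw by (simp add: algebra_simps)
    also have "\<dots> = \<psi> z"
      unfolding rec \<psi>_def T_def by (simp add: algebra_simps power2_eq_square)
    finally show ?thesis .
  qed
  moreover have "continuous_on {0..T} \<Psi>"
    unfolding \<Psi>_def using assms
    by (intro continuous_intros continuous_on_powr') auto
  ultimately obtain z where z: "0 < z" "z < T" and eq: "\<Psi> T - \<Psi> 0 = (T - 0) * \<psi> z"
    using MVT[OF T, of \<Psi>] by (metis DERIV_unique real_differentiable_def)
  have "\<psi> z < 0"
    using pos[OF z(1)] z T by (simp add: \<psi>_def add_nonneg_pos)
  moreover have "\<Psi> T = 0" "\<Psi> 0 = 0" by (simp_all add: \<Psi>_def)
  ultimately show False using eq T by simp
qed

lemma clifford_first_zero:
  assumes "\<mu> \<ge> 0"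
  obtains t where "t > 0" "clifford \<mu> t = 0" "\<And>s. 0 \<le> s \<Longrightarrow> s < t \<Longrightarrow> clifford \<mu> s > 0"
proof -
  obtain T where T: "T > 0" "clifford \<mu> T = 0" using clifford_has_zero[OF assms] by blast
  define Z where "Z = {0..T} \<inter> clifford \<mu> -` {0}"
  have "compact Z"
    unfolding Z_def by (intro continuous_closed_preimage compact_Int_closed compact_Icc closed_vimage continuous_intros assms)
  moreover have "T \<in> Z" using T by (auto simp: Z_def)
  then have "Z \<noteq> {}" by blast
  ultimately obtain t where t: "t \<in> Z" "\<And>s. s \<in> Z \<Longrightarrow> t \<le> s"
    using compact_attains_inf by metis
  have "t \<noteq> 0" using t(1) clifford_0_pos[OF assms] by (auto simp: Z_def)
  then have "t > 0" using t(1) by (auto simp: Z_def)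
  moreover have "clifford \<mu> s > 0" if "0 \<le> s" "s < t" for s
  proof (rule clifford_pos_of_no_zero[OF assms _ that(1)])
    fix r assume "0 < r" "r \<le> s"
    with that t(1) t(2)[of r] show "clifford \<mu> r \<noteq> 0" by (auto simp: Z_def)
  qed
  ultimately show ?thesis using that t(1) by (auto simp: Z_def)
qed

text \<open>The cardinality in the definition of the first zero counts all zeros up to \<open>x\<close>; it is \<open>1\<close> only at
  the smallest one.\<close>

lemma Bessel_zero_1_eqI:
  assumes "\<mu> \<ge> 0" "t > 0" "clifford \<mu> t = 0" and pos: "\<And>s. 0 \<le> s \<Longrightarrow> s < t \<Longrightarrow> clifford \<mu> s > 0"
  shows "Bessel_zero \<mu> 1 = 2 * sqrt t"
  unfolding Bessel_zero_def
proof (rule the_equality)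
  have J: "Bessel_J \<mu> x = 0 \<longleftrightarrow> clifford \<mu> (x\<^sup>2 / 4) = 0" if "x > 0" for x
    using that by (simp add: Bessel_J_eq_clifford[OF that assms(1)])
  have sq: "(2 * sqrt t)\<^sup>2 / 4 = t" using assms by (simp add: power_mult_distrib)
  have set: "{y. 0 < y \<and> y \<le> 2 * sqrt t \<and> Bessel_J \<mu> y = 0} = {2 * sqrt t}"
  proof (intro equalityI subsetI)
    fix y assume y: "y \<in> {y. 0 < y \<and> y \<le> 2 * sqrt t \<and> Bessel_J \<mu> y = 0}"
    then have "clifford \<mu> (y\<^sup>2 / 4) = 0" using J by blast
    then have "\<not> y\<^sup>2 / 4 < t" using pos[of "y\<^sup>2 / 4"] by auto
    moreover have "y\<^sup>2 \<le> (2 * sqrt t)\<^sup>2" using y by (intro power_mono) auto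
    ultimately have "y\<^sup>2 = (2 * sqrt t)\<^sup>2" using sq by simp
    then show "y \<in> {2 * sqrt t}"
      using y power2_eq_imp_eq[of y "2 * sqrt t"] \<open>t > 0\<close> by simp
  next
    fix y assume "y \<in> {2 * sqrt t}"
    then show "y \<in> {y. 0 < y \<and> y \<le> 2 * sqrt t \<and> Bessel_J \<mu> y = 0}"
      using J[of y] sq assms by auto
  qed
  show "0 < 2 * sqrt t \<and> Bessel_J \<mu> (2 * sqrt t) = 0 \<and>
    card {y. 0 < y \<and> y \<le> 2 * sqrt t \<and> Bessel_J \<mu> y = 0} = 1"
    using J[of "2 * sqrt t"] sq assms by (simp add: set)
  fix x assume x: "x > 0 \<and> Bessel_J \<mu> x = 0 \<and> card {y. 0 < y \<and> y \<le> x \<and> Bessel_J \<mu> y = 0} = 1"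
  then obtain z where z: "{y. 0 < y \<and> y \<le> x \<and> Bessel_J \<mu> y = 0} = {z}"
    by (auto simp: card_1_singleton_iff)
  have "x \<in> {y. 0 < y \<and> y \<le> x \<and> Bessel_J \<mu> y = 0}" using x by blast
  then have "x = z" unfolding z by blast
  have "clifford \<mu> (x\<^sup>2 / 4) = 0" using J x by blast
  then have "\<not> x\<^sup>2 / 4 < t" using pos[of "x\<^sup>2 / 4"] by auto
  then have "(2 * sqrt t)\<^sup>2 \<le> x\<^sup>2" using sq by simp
  then have "2 * sqrt t \<le> x" by (rule power2_le_imp_le) (use x in simp)
  then have "2 * sqrt t \<in> {y. 0 < y \<and> y \<le> x \<and> Bessel_J \<mu> y = 0}"
    using J[of "2 * sqrt t"] sq assms by auto
  then show "x = 2 * sqrt t" unfolding z \<open>x = z\<close>[symmetric] by blast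
qed

text \<open>The first zero of \<open>J\<^sub>\<nu>\<close> precedes that of \<open>J\<^sub>\<nu>\<^sub>+\<^sub>1\<close>: if \<open>f\<^sub>\<nu>\<close> stayed positive up to the first zero
  \<open>t\<close> of \<open>f\<^sub>\<nu>\<^sub>+\<^sub>1\<close>, then \<open>(z\<^sup>\<nu>\<^sup>+\<^sup>1 f\<^sub>\<nu>\<^sub>+\<^sub>1)' = z\<^sup>\<nu> f\<^sub>\<nu>\<close> would make \<open>z\<^sup>\<nu>\<^sup>+\<^sup>1 f\<^sub>\<nu>\<^sub>+\<^sub>1\<close> increase from \<open>0\<close> to \<open>0\<close>.
  Between the two zeros \<open>f\<^sub>\<nu>\<close> is negative because its derivative is \<open>- f\<^sub>\<nu>\<^sub>+\<^sub>1\<close>. This interval, in the variable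
  \<open>t = (pi \<alpha> / 2)\<^sup>2\<close>, is the admissible range of \<open>\<alpha>\<close>.\<close>

lemma clifford_consecutive_zeros:
  assumes "\<nu> \<ge> 0"
  obtains s t where "0 < s" "s < t" "Bessel_zero \<nu> 1 = 2 * sqrt s" "Bessel_zero (\<nu> + 1) 1 = 2 * sqrt t"
    "\<And>r. s < r \<Longrightarrow> r \<le> t \<Longrightarrow> clifford \<nu> r < 0"
    "\<And>r. 0 \<le> r \<Longrightarrow> r < t \<Longrightarrow> clifford (\<nu> + 1) r > 0" "clifford (\<nu> + 1) t = 0"
proof -
  have \<nu>: "\<nu> + 1 \<ge> 0" using assms by simp
  obtain s where s: "s > 0" "clifford \<nu> s = 0" "\<And>r. 0 \<le> r \<Longrightarrow> r < s \<Longrightarrow> clifford \<nu> r > 0"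
    using clifford_first_zero[OF assms] by metis
  obtain t where t: "t > 0" "clifford (\<nu> + 1) t = 0" "\<And>r. 0 \<le> r \<Longrightarrow> r < t \<Longrightarrow> clifford (\<nu> + 1) r > 0"
    using clifford_first_zero[OF \<nu>] by metis
  have "s < t"
  proof (rule ccontr)
    assume "\<not> s < t"
    define G where "G z = z powr (\<nu> + 1) * clifford (\<nu> + 1) z" for z
    have "(G has_real_derivative z powr \<nu> * clifford \<nu> z) (at z)" if z: "0 < z" "z < t" for z
    proof -
      have "((\<lambda>z. z powr (\<nu> + 1)) has_real_derivative (\<nu> + 1) * z powr \<nu>) (at z)"
        using has_real_derivative_powr[OF z(1), of "\<nu> + 1"] by simp
      from DERIV_mult[OF this has_real_derivative_clifford[OF \<nu>, of z]]
      have "(G has_real_derivative (\<nu> + 1) * z powr \<nu> * clifford (\<nu> + 1) z - clifford (\<nu> + 2) z * z powr (\<nu> + 1)) (at z)"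
        unfolding G_def by (simp add: add.assoc)
      also have "(\<nu> + 1) * z powr \<nu> * clifford (\<nu> + 1) z - clifford (\<nu> + 2) z * z powr (\<nu> + 1)
          = z powr \<nu> * clifford \<nu> z"
        unfolding clifford_rec[OF assms, of z] using z by (simp add: powr_add algebra_simps)
      finally show ?thesis .
    qed
    moreover have "continuous_on {0..t} G"
      unfolding G_def using assms by (intro continuous_intros continuous_on_powr') auto
    ultimately obtain z where z: "0 < z" "z < t" and eq: "G t - G 0 = (t - 0) * (z powr \<nu> * clifford \<nu> z)"
      using MVT[OF t(1), of G] by (metis DERIV_unique real_differentiable_def)
    have "clifford \<nu> z > 0" using s(3)[of z] z \<open>\<not> s < t\<close> by simp
    then show False using eq t z by (simp add: G_def)
  qed
  moreover have "clifford \<nu> r < 0" if r: "s < r" "r \<le> t" for r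
  proof -
    have "clifford \<nu> r < clifford \<nu> s"
    proof (rule DERIV_neg_imp_decreasing_open[OF r(1)])
      fix x assume "s < x" "x < r"
      then show "\<exists>y. DERIV (clifford \<nu>) x :> y \<and> y < 0"
        using has_real_derivative_clifford[OF assms, of x] t(3)[of x] s(1) r by force
    qed (intro continuous_on_clifford assms continuous_on_id)
    then show ?thesis using s by simp
  qed
  ultimately show ?thesis
    using that[of s t] s t Bessel_zero_1_eqI[OF assms s] Bessel_zero_1_eqI[OF \<nu> t] by auto
qed

lemma clifford_decreasing:
  assumes "\<nu> \<ge> 0" "\<And>r. 0 \<le> r \<Longrightarrow> r < T \<Longrightarrow> clifford (\<nu> + 1) r > 0" "0 \<le> a" "a \<le> b" "b \<le> T"
  shows "clifford \<nu> b \<le> clifford \<nu> a"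
proof (cases "a = b")
  case False
  have ab: "a < b" using assms False by simp
  have "clifford \<nu> b < clifford \<nu> a"
  proof (rule DERIV_neg_imp_decreasing_open[OF ab])
    fix x assume "a < x" "x < b"
    then show "\<exists>y. DERIV (clifford \<nu>) x :> y \<and> y < 0"
      using has_real_derivative_clifford[OF assms(1), of x] assms(2)[of x] assms by force
  qed (intro continuous_on_clifford assms continuous_on_id)
  then show ?thesis by simp
qed simp

lemma has_real_derivative_clifford_scaled:
  assumes "\<nu> \<ge> 0"
  shows "((\<lambda>s. k * clifford \<nu> (c * s)) has_real_derivative (- c * k) * clifford (\<nu> + 1) (c * s)) (at s)"
  by (rule derivative_eq_intros DERIV_chain2[OF has_real_derivative_clifford[OF assms]] refl)+ simp

section \<open>Integer points and Riemann sums\<close>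

lemma int_lattice_add: "x \<in> int_lattice \<Longrightarrow> y \<in> int_lattice \<Longrightarrow> x + y \<in> int_lattice"
  by (simp add: int_lattice_def)

lemma int_lattice_diff: "x \<in> int_lattice \<Longrightarrow> y \<in> int_lattice \<Longrightarrow> x - y \<in> int_lattice"
  by (simp add: int_lattice_def)

lemma int_lattice_uminus: "x \<in> int_lattice \<Longrightarrow> - x \<in> int_lattice"
  by (simp add: int_lattice_def)

lemma int_lattice_zero: "0 \<in> int_lattice"
  by (simp add: int_lattice_def)

lemma int_lattice_axis: "axis j 1 \<in> int_lattice"
  by (simp add: int_lattice_def axis_def)

lemma norm_int_lattice_ge_1:
  assumes "k \<in> int_lattice" "k \<noteq> 0"
  shows "norm k \<ge> 1"
proof -
  obtain i where i: "k $ i \<noteq> 0" using assms(2) by (auto simp: vec_eq_iff)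
  obtain z where z: "k $ i = of_int z" using assms(1) by (auto simp: int_lattice_def elim: Ints_cases)
  then have "\<bar>z\<bar> \<ge> 1" using i by auto
  then have "\<bar>k $ i\<bar> \<ge> 1" unfolding z by linarith
  then show ?thesis using component_le_norm_cart[of k i] by linarith
qed

lemma finite_lattice_cball: "finite (int_lattice \<inter> cball (0 :: real ^ 'n) r)"
proof (rule finite_subset)
  show "int_lattice \<inter> cball (0 :: real ^ 'n) r \<subseteq>
      (\<lambda>g. \<chi> i. of_int (g i)) ` PiE UNIV (\<lambda>_. {- \<lceil>r\<rceil>..\<lceil>r\<rceil>})"
  proof
    fix x :: "real ^ 'n"
    assume x: "x \<in> int_lattice \<inter> cball 0 r"
    have "\<bar>x $ i\<bar> \<le> r" for i
      using x component_le_norm_cart[of x i] by simp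
    then have "- \<lceil>r\<rceil> \<le> \<lfloor>x $ i\<rfloor> \<and> \<lfloor>x $ i\<rfloor> \<le> \<lceil>r\<rceil>" for i
      by (smt (verit) ceiling_mono floor_le_ceiling floor_mono ceiling_minus le_floor_iff of_int_minus le_of_int_ceiling)
    moreover have "x = (\<chi> i. of_int \<lfloor>x $ i\<rfloor>)"
      using x by (auto simp: int_lattice_def vec_eq_iff)
    ultimately show "x \<in> (\<lambda>g. \<chi> i. of_int (g i)) ` PiE UNIV (\<lambda>_. {- \<lceil>r\<rceil>..\<lceil>r\<rceil>})"
      by (intro image_eqI[of _ _ "\<lambda>i. \<lfloor>x $ i\<rfloor>"]) (simp_all add: PiE_UNIV_domain)
  qed
qed (intro finite_imageI finite_PiE, auto)

definition grid_floor :: "real ^ 'n \<Rightarrow> real ^ 'n" where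
  "grid_floor x = (\<chi> i. of_int \<lfloor>x $ i\<rfloor>)"

lemma grid_floor_lattice: "grid_floor x \<in> int_lattice"
  by (simp add: grid_floor_def int_lattice_def)

lemma norm_grid_floor_diff:
  fixes x :: "real ^ 'n"
  shows "norm (grid_floor x - x) \<le> real CARD('n)"
proof -
  have "norm (grid_floor x - x) \<le> (\<Sum>i\<in>UNIV. \<bar>(grid_floor x - x) $ i\<bar>)"
    by (rule norm_le_l1_cart)
  also have "\<dots> \<le> (\<Sum>i\<in>(UNIV :: 'n set). 1)"
    by (intro sum_mono) (simp add: grid_floor_def, linarith)
  finally show ?thesis by simp
qed

lemma norm_grid_floor_scaled_diff:
  fixes x :: "real ^ 'n"
  assumes "N > 0"
  shows "norm ((1 / N) *\<^sub>R grid_floor (N *\<^sub>R x) - x) \<le> real CARD('n) / N"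
proof -
  have "(1 / N) *\<^sub>R grid_floor (N *\<^sub>R x) - x = (1 / N) *\<^sub>R (grid_floor (N *\<^sub>R x) - N *\<^sub>R x)"
    using assms by (simp add: scaleR_right_diff_distrib)
  also have "norm \<dots> \<le> real CARD('n) / N"
    using norm_grid_floor_diff[of "N *\<^sub>R x"] assms by (simp add: divide_right_mono)
  finally show ?thesis .
qed

lemma grid_floor_tendsto:
  fixes x :: "real ^ 'n"
  shows "(\<lambda>N. (1 / real N) *\<^sub>R grid_floor (real N *\<^sub>R x)) \<longlonglongrightarrow> x"
proof (rule LIM_zero_cancel, rule Lim_null_comparison)
  show "\<forall>\<^sub>F N in sequentially. norm ((1 / real N) *\<^sub>R grid_floor (real N *\<^sub>R x) - x) \<le> real CARD('n) / real N"
    using eventually_gt_at_top[of 0]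
    by eventually_elim (rule norm_grid_floor_scaled_diff, simp)
  show "(\<lambda>N. real CARD('n) / real N) \<longlonglongrightarrow> 0"
    by (rule lim_const_over_n)
qed

lemma grid_cell:
  fixes k :: "real ^ 'n"
  assumes "N > 0" "k \<in> int_lattice"
  shows "{x. grid_floor (N *\<^sub>R x) = k} \<in> sets lborel"
    "emeasure lborel {x. grid_floor (N *\<^sub>R x) = k} = ennreal ((1 / N) ^ CARD('n))"
proof -
  define Q where "Q = {x. grid_floor (N *\<^sub>R x) = k}"
  have Q: "Q = (\<Inter>i. {x. k $ i \<le> N * x $ i} \<inter> {x. N * x $ i < k $ i + 1})"
  proof -
    have "of_int \<lfloor>y\<rfloor> = k $ i \<longleftrightarrow> k $ i \<le> y \<and> y < k $ i + 1" for y i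
    proof -
      obtain z where "k $ i = of_int z" using assms(2) by (auto simp: int_lattice_def elim: Ints_cases)
      then show ?thesis by (auto simp: floor_eq_iff)
    qed
    then show ?thesis by (auto simp: Q_def grid_floor_def vec_eq_iff)
  qed
  have "closed {x :: real ^ 'n. k $ i \<le> N * x $ i}" "open {x :: real ^ 'n. N * x $ i < k $ i + 1}" for i
    by (intro closed_Collect_le open_Collect_less continuous_intros)+
  then show Qs: "Q \<in> sets lborel"
    unfolding Q by (auto intro!: sets.finite_INT borel_open borel_closed)
  define b where "b = k + (\<chi> i. 1)"
  have cont: "(\<Prod>e\<in>Basis. (((1 / N) *\<^sub>R b) - (1 / N) *\<^sub>R k) \<bullet> e) = (1 / N) ^ CARD('n)"
  proof -
    have "(((1 / N) *\<^sub>R b) - (1 / N) *\<^sub>R k) \<bullet> e = 1 / N" if "e \<in> Basis" for e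
      using that by (auto simp: Basis_vec_def inner_axis b_def algebra_simps)
    then show ?thesis by simp
  qed
  have le: "\<forall>e\<in>Basis. ((1 / N) *\<^sub>R k) \<bullet> e \<le> ((1 / N) *\<^sub>R b) \<bullet> e"
    using assms by (auto simp: Basis_vec_def inner_axis b_def divide_right_mono)
  have "box ((1 / N) *\<^sub>R k) ((1 / N) *\<^sub>R b) \<subseteq> Q" "Q \<subseteq> cbox ((1 / N) *\<^sub>R k) ((1 / N) *\<^sub>R b)"
    using assms(1) by (force simp: Q mem_box_cart b_def field_simps intro: less_imp_le)+
  then have "emeasure lborel (box ((1 / N) *\<^sub>R k) ((1 / N) *\<^sub>R b)) \<le> emeasure lborel Q"
    "emeasure lborel Q \<le> emeasure lborel (cbox ((1 / N) *\<^sub>R k) ((1 / N) *\<^sub>R b))"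
    using Qs by (auto intro!: emeasure_mono)
  then show "emeasure lborel Q = ennreal ((1 / N) ^ CARD('n))"
    using le cont by (simp add: emeasure_lborel_cbox_eq emeasure_lborel_box_eq)
qed

text \<open>The cells \<open>{x. grid_floor (N x) = k}\<close> are cubes of side \<open>1 / N\<close>, so the step function that samples
  \<open>F\<close> at the corner of each cell has the Riemann sum of \<open>F\<close> as its integral.\<close>

lemma integral_grid_step:
  fixes F :: "real ^ 'n \<Rightarrow> real"
  assumes "N > 0" and supp: "\<And>x. F x \<noteq> 0 \<Longrightarrow> norm x \<le> r"
  shows "has_bochner_integral lborel (\<lambda>x. F ((1 / N) *\<^sub>R grid_floor (N *\<^sub>R x)))
    ((1 / N) ^ CARD('n) * (\<Sum>k\<in>int_lattice \<inter> cball 0 (N * r). F ((1 / N) *\<^sub>R k)))"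
proof -
  let ?K = "int_lattice \<inter> cball (0 :: real ^ 'n) (N * r)"
  have eq: "F ((1 / N) *\<^sub>R grid_floor (N *\<^sub>R x)) =
      (\<Sum>k\<in>?K. F ((1 / N) *\<^sub>R k) * indicator {x. grid_floor (N *\<^sub>R x) = k} x)" for x
  proof (cases "F ((1 / N) *\<^sub>R grid_floor (N *\<^sub>R x)) = 0")
    case True
    then show ?thesis by (intro sum.neutral[symmetric] trans[OF True]) (auto simp: indicator_def)
  next
    case False
    then have "norm ((1 / N) *\<^sub>R grid_floor (N *\<^sub>R x)) \<le> r" by (rule supp)
    then have "grid_floor (N *\<^sub>R x) \<in> ?K"
      using assms(1) by (simp add: grid_floor_lattice field_simps)
    then show ?thesis
      using finite_lattice_cball[of "N * r", where 'n = 'n]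
      by (simp add: indicator_def if_distrib[of "\<lambda>z. _ * z"] sum.delta' cong: if_cong)
  qed
  show ?thesis
    unfolding eq sum_distrib_left
  proof (rule has_bochner_integral_sum)
    fix k :: "real ^ 'n" assume k: "k \<in> ?K"
    have "has_bochner_integral lborel (\<lambda>x. indicator {x. grid_floor (N *\<^sub>R x) = k} x :: real) ((1 / N) ^ CARD('n))"
      using has_bochner_integral_real_indicator[OF grid_cell(1)[OF assms(1), of k]] grid_cell(2)[OF assms(1), of k] k assms(1)
      by (simp add: measure_def)
    from has_bochner_integral_mult_right[OF this, of "F ((1 / N) *\<^sub>R k)"]
    show "has_bochner_integral lborel (\<lambda>x. F ((1 / N) *\<^sub>R k) * indicator {x. grid_floor (N *\<^sub>R x) = k} x)
      ((1 / N) ^ CARD('n) * F ((1 / N) *\<^sub>R k))" by (simp add: mult.commute)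
  qed
qed

text \<open>The step functions of \<open>integral_grid_step\<close> converge to \<open>F\<close> wherever \<open>F\<close> is continuous, and dominated
  convergence applies. Discontinuities on a null set are allowed because one of the integrands is
  cut off at a sphere.\<close>

lemma riemann_sum_tendsto:
  fixes F :: "real ^ 'n \<Rightarrow> real"
  assumes meas: "F \<in> borel_measurable lborel" and supp: "\<And>x. F x \<noteq> 0 \<Longrightarrow> norm x \<le> r"
    and bound: "\<And>x. \<bar>F x\<bar> \<le> C" and cont: "AE x in lborel. isCont F x"
  shows "(\<lambda>N. (1 / real N) ^ CARD('n) * (\<Sum>k\<in>int_lattice \<inter> cball 0 (real N * r). F ((1 / real N) *\<^sub>R k)))
    \<longlonglongrightarrow> (\<integral>x. F x \<partial>lborel)"
proof -
  define s where "s N x = F ((1 / real (Suc N)) *\<^sub>R grid_floor (real (Suc N) *\<^sub>R x))" for N x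
  have s: "has_bochner_integral lborel (s N) ((1 / real (Suc N)) ^ CARD('n) *
      (\<Sum>k\<in>int_lattice \<inter> cball 0 (real (Suc N) * r). F ((1 / real (Suc N)) *\<^sub>R k)))" for N
    unfolding s_def by (rule integral_grid_step) (use supp in auto)
  let ?w = "\<lambda>x :: real ^ 'n. C * indicator (cball 0 (r + real CARD('n))) x"
  have "(\<lambda>N. integral\<^sup>L lborel (s N)) \<longlonglongrightarrow> integral\<^sup>L lborel F"
  proof (rule integral_dominated_convergence[where w = ?w])
    show "F \<in> borel_measurable lborel" by (rule meas)
    show "s N \<in> borel_measurable lborel" for N using s[of N] by (auto simp: has_bochner_integral_iff)
    show "integrable lborel ?w"
      by (intro integrable_mult_right integrable_real_indicator)
        (use emeasure_bounded_finite[OF bounded_cball, of "0 :: real ^ 'n" "r + real CARD('n)"] in \<open>simp_all add: less_top\<close>)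
    show "AE x in lborel. (\<lambda>N. s N x) \<longlonglongrightarrow> F x"
      using cont
    proof eventually_elim
      case (elim x)
      have "(\<lambda>N. F ((1 / real N) *\<^sub>R grid_floor (real N *\<^sub>R x))) \<longlonglongrightarrow> F x"
        by (rule isCont_tendsto_compose[OF elim grid_floor_tendsto])
      then show ?case unfolding s_def by (rule LIMSEQ_Suc)
    qed
    show "AE x in lborel. norm (s N x) \<le> ?w x" for N
    proof (rule AE_I2)
      fix x
      show "norm (s N x) \<le> ?w x"
      proof (cases "s N x = 0")
        case True
        then show ?thesis using bound[of 0] by (simp add: indicator_def)
      next
        case False
        have "norm x \<le> norm ((1 / real (Suc N)) *\<^sub>R grid_floor (real (Suc N) *\<^sub>R x)) +
            norm ((1 / real (Suc N)) *\<^sub>R grid_floor (real (Suc N) *\<^sub>R x) - x)"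
          by (metis norm_triangle_sub norm_minus_commute)
        also have "\<dots> \<le> r + real CARD('n) / real (Suc N)"
          using False by (intro add_mono norm_grid_floor_scaled_diff supp) (auto simp: s_def)
        also have "\<dots> \<le> r + real CARD('n)" by (simp add: field_simps)
        finally show ?thesis using bound by (simp add: s_def)
      qed
    qed
  qed
  then show ?thesis
    using s by (subst filterlim_sequentially_Suc[symmetric]) (simp add: has_bochner_integral_iff del: of_nat_Suc)
qed

section \<open>Characters and finite Fourier analysis\<close>

lemma char_exp_add: "char_exp n (x + y) = char_exp n x * char_exp n y"
  by (simp add: char_exp_def inner_add_right exp_add[symmetric] algebra_simps)

lemma char_exp_minus: "char_exp n (- x) = cnj (char_exp n x)"
  by (simp add: char_exp_def exp_cnj)

lemma norm_char_exp: "cmod (char_exp n x) = 1"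
  by (simp add: char_exp_def norm_exp_eq_Re)

lemma char_exp_diff: "char_exp n (x - y) = char_exp n x * cnj (char_exp n y)"
  using char_exp_add[of n x "- y"] by (simp add: char_exp_minus)

lemma cos_via_char_exp: "char_exp n x + cnj (char_exp n x) = of_real (2 * cos (2 * pi * (n \<bullet> x)))"
proof -
  have "char_exp n x = cis (- (2 * pi * (n \<bullet> x)))"
    unfolding char_exp_def cis_conv_exp by (simp add: mult_ac)
  then show ?thesis by (simp add: complex_eq_iff)
qed

text \<open>If \<open>N\<close> does not divide \<open>k\<close>, shifting the summation index multiplies the sum by
  \<open>exp \<theta> \<noteq> 1\<close>. The shift also leaves the sum unchanged, because the summand has period \<open>N\<close> and the range is
  a complete residue system. So the sum is \<open>0\<close>.\<close>

lemma exp_sum_symmetric_range: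
  fixes M :: nat and k :: int
  defines "N \<equiv> 2 * M + 1"
  shows "(\<Sum>j\<in>{- int M..int M}. exp (- 2 * of_real pi * \<i> * of_real (of_int j * (of_int k / real N)))) =
    (if int N dvd k then of_nat N else 0 :: complex)"
proof -
  define \<theta> where "\<theta> = - 2 * of_real pi * \<i> * of_real (of_int k / real N)"
  define S where "S = (\<Sum>j\<in>{- int M..int M}. exp (of_int j * \<theta>))"
  have N: "N > 0" by (simp add: N_def)
  have eq: "(\<Sum>j\<in>{- int M..int M}. exp (- 2 * of_real pi * \<i> * of_real (of_int j * (of_int k / real N)))) = S"
    by (simp add: S_def \<theta>_def mult_ac)
  show ?thesis
  proof (cases "int N dvd k")
    case True
    then obtain l where l: "k = int N * l" by (auto elim: dvdE)
    have "exp (of_int j * \<theta>) = 1" for j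
    proof -
      have "of_int j * \<theta> = of_int (- j * l) * (of_real (2 * pi) * \<i>)"
        using N by (simp add: \<theta>_def l)
      then show ?thesis
        by (simp only: exp_eq_1) (auto intro!: exI[of _ "- j * l"])
    qed
    then have "S = of_nat N" by (simp add: S_def N_def)
    then show ?thesis using True by (simp only: eq if_True)
  next
    case False
    have "exp \<theta> \<noteq> 1"
    proof
      assume "exp \<theta> = 1"
      then obtain n :: int where "- (2 * pi * of_int k / real N) = of_int (2 * n) * pi"
        by (auto simp: exp_eq_1 \<theta>_def)
      then have "pi * (- (of_int k)) = pi * (of_int n * (of_nat N :: real))"
        using N by (simp add: field_simps)
      then have "- (of_int k) = of_int n * (of_nat N :: real)"
        by (simp only: mult_cancel_left pi_neq_zero simp_thms)
      then have "k = int N * (- n)"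
        by (metis mult.commute mult_minus_right minus_minus of_int_eq_iff of_int_minus of_int_mult of_int_of_nat_eq)
      then show False using False by simp
    qed
    moreover have "exp \<theta> * S = S"
    proof -
      have per: "exp (of_int (int M + 1) * \<theta>) = exp (of_int (- int M) * \<theta>)"
      proof -
        have "of_int (int M + 1) * \<theta> = of_int (- int M) * \<theta> + of_nat N * \<theta>"
          by (simp add: N_def algebra_simps)
        moreover have "of_nat N * \<theta> = of_int (- k) * (of_real (2 * pi) * \<i>)"
          using N by (simp add: \<theta>_def)
        moreover have "exp (of_int (- k) * (of_real (2 * pi) * \<i>)) = 1"
          by (simp only: exp_eq_1) (auto intro!: exI[of _ "- k"])
        ultimately show ?thesis by (simp only: exp_add mult_1_right)
      qed
      have "exp \<theta> * S = (\<Sum>j\<in>{- int M..int M}. exp (of_int (j + 1) * \<theta>))"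
        by (simp add: S_def sum_distrib_left exp_add[symmetric] algebra_simps)
      also have "\<dots> = (\<Sum>j\<in>{- int M + 1..int M + 1}. exp (of_int j * \<theta>))"
        by (rule sum.reindex_bij_witness[of _ "\<lambda>j. j - 1" "\<lambda>j. j + 1"]) auto
      also have "{- int M + 1..int M + 1} = insert (int M + 1) ({- int M..int M} - {- int M})" by auto
      also have "(\<Sum>j\<in>\<dots>. exp (of_int j * \<theta>)) = S"
        by (subst sum.insert) (simp_all only: per S_def, auto simp: sum_diff1)
      finally show ?thesis .
    qed
    ultimately have "S = 0" by simp
    then show ?thesis using False by (simp only: eq if_False)
  qed
qed

text \<open>The frequencies of the grid of mesh \<open>1 / (2 M + 1)\<close>, represented by residues of least absolute value;
  only for these does a positive symbol of the discrete operator force the frequency to be small.\<close>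

definition freq_box :: "nat \<Rightarrow> (real ^ 'n) set" where
  "freq_box M = {n \<in> int_lattice. \<forall>i. \<bar>n $ i\<bar> \<le> real M}"

lemma freq_box_eq_image:
  "freq_box M = (\<lambda>g. \<chi> i. of_int (g i)) ` PiE UNIV (\<lambda>_ :: 'n :: finite. {- int M..int M})"
proof (intro equalityI subsetI)
  fix x :: "real ^ 'n" assume x: "x \<in> freq_box M"
  have fl: "of_int \<lfloor>x $ i\<rfloor> = x $ i" for i
    using x by (auto simp: int_lattice_def freq_box_def)
  then have "x = (\<chi> i. of_int \<lfloor>x $ i\<rfloor>)" by (auto simp only: vec_eq_iff vec_lambda_beta)
  moreover have "\<bar>of_int \<lfloor>x $ i\<rfloor> :: real\<bar> \<le> of_int (int M)" for i
    unfolding fl using x by (simp add: freq_box_def)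
  then have "\<bar>\<lfloor>x $ i\<rfloor>\<bar> \<le> int M" for i
    by (simp only: of_int_abs[symmetric] of_int_le_iff)
  then have "- int M \<le> \<lfloor>x $ i\<rfloor> \<and> \<lfloor>x $ i\<rfloor> \<le> int M" for i
    by (metis abs_le_iff minus_le_iff)
  ultimately show "x \<in> (\<lambda>g. \<chi> i. of_int (g i)) ` PiE UNIV (\<lambda>_ :: 'n :: finite. {- int M..int M})"
    by (intro image_eqI[of _ _ "\<lambda>i. \<lfloor>x $ i\<rfloor>"]) (simp_all add: PiE_UNIV_domain)
next
  fix x :: "real ^ 'n" assume "x \<in> (\<lambda>g. \<chi> i. of_int (g i)) ` PiE UNIV (\<lambda>_ :: 'n :: finite. {- int M..int M})"
  then obtain g where g': "g \<in> PiE UNIV (\<lambda>_ :: 'n. {- int M..int M})" and x: "x = (\<chi> i. of_int (g i))"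
    by blast
  have g: "- int M \<le> g i \<and> g i \<le> int M" for i
    using PiE_mem[OF g' UNIV_I] by simp
  have "\<bar>of_int (g i) :: real\<bar> \<le> real M" for i
    using g[of i] by linarith
  then show "x \<in> freq_box M"
    by (auto simp: freq_box_def int_lattice_def x)
qed

lemma finite_freq_box: "finite (freq_box M :: (real ^ 'n) set)"
  unfolding freq_box_eq_image by (intro finite_imageI finite_PiE) auto

text \<open>The character sum factors over the coordinates.\<close>

lemma freq_box_orthogonality:
  fixes k :: "real ^ 'n" and M :: nat
  defines "N \<equiv> 2 * M + 1"
  assumes k: "k \<in> int_lattice"
  shows "(\<Sum>n\<in>freq_box M. char_exp n ((1 / real N) *\<^sub>R k)) =
    (if \<exists>j\<in>int_lattice. k = real N *\<^sub>R j then of_nat N ^ CARD('n) else 0)"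
proof -
  define z where "z i = \<lfloor>k $ i\<rfloor>" for i
  have z: "k $ i = of_int (z i)" for i
    using k by (auto simp: int_lattice_def z_def)
  define E where "E i j = exp (- 2 * of_real pi * \<i> * of_real (of_int j * (of_int (z i) / real N)))" for i j
  have inj: "inj_on (\<lambda>g. (\<chi> i. of_int (g i)) :: real ^ 'n) (PiE UNIV (\<lambda>_. {- int M..int M}))"
    by (auto simp: inj_on_def vec_eq_iff fun_eq_iff)
  have "char_exp (\<chi> i. of_int (g i)) ((1 / real N) *\<^sub>R k) = (\<Prod>i\<in>UNIV. E i (g i))" for g :: "'n \<Rightarrow> int"
    unfolding char_exp_def E_def exp_sum[OF finite, symmetric] inner_vec_def
    by (simp add: z sum_distrib_left)
  then have "(\<Sum>n\<in>freq_box M. char_exp n ((1 / real N) *\<^sub>R k)) =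
      (\<Sum>g\<in>PiE UNIV (\<lambda>_ :: 'n :: finite. {- int M..int M}). \<Prod>i\<in>UNIV. E i (g i))"
    unfolding freq_box_eq_image by (simp add: sum.reindex[OF inj])
  also have "\<dots> = (\<Prod>i\<in>UNIV. \<Sum>j\<in>{- int M..int M}. E i j)"
    by (rule prod_sum_PiE[symmetric]) auto
  also have "\<dots> = (\<Prod>i\<in>UNIV. if int N dvd z i then of_nat N else 0)"
    unfolding E_def N_def exp_sum_symmetric_range ..
  also have "\<dots> = (if \<forall>i. int N dvd z i then of_nat N ^ CARD('n) else 0)"
    by auto
  also have "(\<forall>i. int N dvd z i) \<longleftrightarrow> (\<exists>j\<in>int_lattice. k = real N *\<^sub>R j)"
  proof
    assume d: "\<forall>i. int N dvd z i"
    define j :: "real ^ 'n" where "j = (\<chi> i. of_int (z i div int N))"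
    have "k $ i = real N * j $ i" for i
    proof -
      have "k $ i = of_int (int N * (z i div int N))" using d z by simp
      then show ?thesis unfolding j_def of_int_mult by simp
    qed
    then have "k = real N *\<^sub>R j" by (simp add: vec_eq_iff)
    moreover have "j \<in> int_lattice" by (simp add: j_def int_lattice_def)
    ultimately show "\<exists>j\<in>int_lattice. k = real N *\<^sub>R j" by blast
  next
    assume "\<exists>j\<in>int_lattice. k = real N *\<^sub>R j"
    then obtain j where j: "j \<in> int_lattice" "k = real N *\<^sub>R j" by blast
    show "\<forall>i. int N dvd z i"
    proof
      fix i
      obtain l where "j $ i = of_int l" using j(1) by (auto simp: int_lattice_def elim: Ints_cases)
      then have "(of_int (z i) :: real) = of_int (int N * l)"
        using j(2) z[of i] by simp
      then show "int N dvd z i" by (simp only: of_int_eq_iff) simp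
    qed
  qed
  finally show ?thesis .
qed

definition disc_lap :: "real \<Rightarrow> (real ^ 'n \<Rightarrow> real) \<Rightarrow> real ^ 'n \<Rightarrow> real" where
  "disc_lap N h y = N\<^sup>2 * (\<Sum>j\<in>UNIV. h (y + axis j (1 / N)) + h (y - axis j (1 / N)) - 2 * h y)"

text \<open>The Fourier multiplier of \<open>h \<mapsto> h + \<kappa> \<Delta>h\<close> for the second-difference Laplacian; it converges to
  \<open>1 - 4 pi\<^sup>2 \<kappa> |n|\<^sup>2\<close>.\<close>

definition disc_symbol :: "real \<Rightarrow> real \<Rightarrow> real ^ 'n \<Rightarrow> real" where
  "disc_symbol \<kappa> N n = 1 - 4 * \<kappa> * N\<^sup>2 * (\<Sum>j\<in>UNIV. (sin (pi * n $ j / N))\<^sup>2)"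

text \<open>The parameter \<open>r\<close> only truncates the sum. It is chosen larger than the support of \<open>h\<close> by at least one
  grid step, so that shifts by one step lose nothing.\<close>

definition grid_transform :: "real \<Rightarrow> real \<Rightarrow> (real ^ 'n \<Rightarrow> real) \<Rightarrow> real ^ 'n \<Rightarrow> complex" where
  "grid_transform r N h n =
     (\<Sum>y\<in>int_lattice \<inter> cball 0 (N * r). of_real (h ((1 / N) *\<^sub>R y)) * char_exp n ((1 / N) *\<^sub>R y))"

lemma grid_transform_shift:
  fixes h :: "real ^ 'n \<Rightarrow> real"
  assumes "N > 0" and supp: "\<And>y. h y \<noteq> 0 \<Longrightarrow> norm y \<le> R" and r: "N * R + 1 \<le> N * r"
    and v: "v \<in> int_lattice" "norm v \<le> 1"
  shows "grid_transform r N (\<lambda>y. h (y + (1 / N) *\<^sub>R v)) n = cnj (char_exp n ((1 / N) *\<^sub>R v)) * grid_transform r N h n"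
proof -
  let ?K = "int_lattice \<inter> cball (0 :: real ^ 'n) (N * r)"
  have inK: "y \<in> ?K \<and> y - v \<in> ?K" if "y \<in> int_lattice" "h ((1 / N) *\<^sub>R y) \<noteq> 0" for y
  proof -
    have "norm ((1 / N) *\<^sub>R y) \<le> R" using that supp by blast
    then have "norm y \<le> N * R" using assms(1) by (simp add: field_simps)
    moreover have "norm (y - v) \<le> norm y + 1" using norm_triangle_ineq4[of y v] v by simp
    ultimately show ?thesis using that v r by (simp add: int_lattice_diff)
  qed
  have fin: "finite ?K" by (rule finite_lattice_cball)
  have "grid_transform r N (\<lambda>y. h (y + (1 / N) *\<^sub>R v)) n =
      (\<Sum>y\<in>?K. of_real (h ((1 / N) *\<^sub>R y)) * char_exp n ((1 / N) *\<^sub>R (y - v)))"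
    unfolding grid_transform_def
  proof (rule sum.reindex_bij_witness_not_neutral[where
        S' = "{y \<in> ?K. h ((1 / N) *\<^sub>R (y + v)) = 0}" and T' = "{y \<in> ?K. h ((1 / N) *\<^sub>R y) = 0}" and
        i = "\<lambda>y. y - v" and j = "\<lambda>y. y + v"], goal_cases)
    case (4 a)
    then show ?case using inK[of "a + v"] v int_lattice_add by auto
  next
    case (6 b)
    then show ?case using inK[of b] v by auto
  qed (auto simp: scaleR_add_right intro: finite_subset[OF _ fin])
  also have "\<dots> = cnj (char_exp n ((1 / N) *\<^sub>R v)) * grid_transform r N h n"
    unfolding grid_transform_def sum_distrib_left scaleR_diff_right char_exp_diff
    by (simp add: mult_ac)
  finally show ?thesis .
qed

text \<open>Each shift by a grid step multiplies the transform by a character value, and the two opposite shifts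
  together give \<open>2 cos 2x - 2 = - 4 sin\<^sup>2 x\<close>.\<close>

lemma grid_transform_laplacian:
  fixes h :: "real ^ 'n \<Rightarrow> real"
  assumes N: "N > 0" and supp: "\<And>y. h y \<noteq> 0 \<Longrightarrow> norm y \<le> R" and r: "N * R + 1 \<le> N * r"
  shows "grid_transform r N (\<lambda>y. h y + \<kappa> * disc_lap N h y) n = of_real (disc_symbol \<kappa> N n) * grid_transform r N h n"
proof -
  let ?K = "int_lattice \<inter> cball (0 :: real ^ 'n) (N * r)"
  let ?T = "grid_transform r N"
  have ax: "(1 / N) *\<^sub>R axis j 1 = axis j (1 / N)" for j :: 'n
    by (simp add: vec_eq_iff axis_def)
  have plus: "?T (\<lambda>y. h (y + axis j (1 / N))) n = cnj (char_exp n (axis j (1 / N))) * ?T h n" for j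
    using grid_transform_shift[where v = "axis j 1" and n = n, OF N supp r int_lattice_axis] by (simp add: ax norm_axis_1)
  have minus: "?T (\<lambda>y. h (y - axis j (1 / N))) n = char_exp n (axis j (1 / N)) * ?T h n" for j
    using grid_transform_shift[where v = "- axis j 1" and n = n, OF N supp r int_lattice_uminus[OF int_lattice_axis]]
    by (simp add: ax norm_axis_1 char_exp_minus)
  have "?T (\<lambda>y. h y + \<kappa> * disc_lap N h y) n = ?T h n + of_real (\<kappa> * N\<^sup>2) * (\<Sum>j\<in>UNIV.
      ?T (\<lambda>y. h (y + axis j (1 / N))) n + ?T (\<lambda>y. h (y - axis j (1 / N))) n - 2 * ?T h n)"
    unfolding grid_transform_def disc_lap_def
    unfolding sum.swap[of _ ?K UNIV] sum_distrib_left[of _ _ ?K] sum_distrib_left[of _ _ UNIV]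
      sum.distrib[symmetric] sum_subtractf[symmetric]
    by (intro sum.cong refl) (simp add: algebra_simps sum_distrib_left sum.distrib sum_subtractf)
  also have "\<dots> = (1 + of_real (\<kappa> * N\<^sup>2) * (\<Sum>j\<in>UNIV. of_real (- 4 * (sin (pi * n $ j / N))\<^sup>2))) * ?T h n"
  proof -
    have "?T (\<lambda>y. h (y + axis j (1 / N))) n + ?T (\<lambda>y. h (y - axis j (1 / N))) n - 2 * ?T h n
        = of_real (- 4 * (sin (pi * n $ j / N))\<^sup>2) * ?T h n" for j
    proof -
      have "?T (\<lambda>y. h (y + axis j (1 / N))) n + ?T (\<lambda>y. h (y - axis j (1 / N))) n - 2 * ?T h n
          = (char_exp n (axis j (1 / N)) + cnj (char_exp n (axis j (1 / N))) - 2) * ?T h n"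
        unfolding plus minus by (simp add: algebra_simps)
      also have "char_exp n (axis j (1 / N)) + cnj (char_exp n (axis j (1 / N))) - 2 =
          of_real (2 * cos (2 * (pi * n $ j / N)) - 2)"
        unfolding cos_via_char_exp by (simp add: inner_axis mult_ac)
      also have "2 * cos (2 * (pi * n $ j / N)) - 2 = - 4 * (sin (pi * n $ j / N))\<^sup>2"
        unfolding cos_double_sin by simp
      finally show ?thesis .
    qed
    then show ?thesis by (simp only: sum_distrib_right[symmetric]) (simp add: algebra_simps)
  qed
  also have "1 + of_real (\<kappa> * N\<^sup>2) * (\<Sum>j\<in>UNIV. of_real (- 4 * (sin (pi * n $ j / N))\<^sup>2)) =
      (of_real (disc_symbol \<kappa> N n) :: complex)"
    unfolding disc_symbol_def of_real_sum[symmetric] sum_distrib_left[symmetric]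
    by (simp add: algebra_simps)
  finally show ?thesis .
qed

text \<open>Outside the ball a nonnegative \<open>h\<close> supported in the ball can only be pushed up by its neighbours. This is
  the discrete trace of the positive surface measure in the distributional Laplacian.\<close>

lemma disc_lap_facts:
  fixes h :: "real ^ 'n \<Rightarrow> real"
  assumes N: "N > 0" and nonneg: "\<And>y. 0 \<le> h y" and supp: "\<And>y. h y \<noteq> 0 \<Longrightarrow> norm y \<le> R"
    and "norm y > R"
  shows "0 \<le> disc_lap N h y" "disc_lap N h y \<noteq> 0 \<Longrightarrow> norm y \<le> R + 1 / N"
proof -
  have h0: "h y = 0" using assms(4) supp[of y] by force
  then show "0 \<le> disc_lap N h y"
    by (auto simp: disc_lap_def nonneg intro!: mult_nonneg_nonneg sum_nonneg)
  show "norm y \<le> R + 1 / N" if ne: "disc_lap N h y \<noteq> 0"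
  proof (rule ccontr)
    assume far: "\<not> norm y \<le> R + 1 / N"
    have "h (y + axis j (1 / N)) = 0" "h (y - axis j (1 / N)) = 0" for j
    proof -
      have "norm (axis j (1 / N) :: real ^ 'n) = 1 / N" 
      proof -
        have "axis j (1 / N) = (1 / N) *\<^sub>R (axis j 1 :: real ^ 'n)" by (simp add: vec_eq_iff axis_def)
        then show ?thesis using N by (simp add: norm_axis_1)
      qed
      then have "norm (y + axis j (1 / N)) > R" "norm (y - axis j (1 / N)) > R"
        using far norm_triangle_ineq4[of "y + axis j (1 / N)" "axis j (1 / N)"]
          norm_triangle_ineq[of "y - axis j (1 / N)" "axis j (1 / N)"] by simp_all
      then show "h (y + axis j (1 / N)) = 0" "h (y - axis j (1 / N)) = 0"
        using supp by (meson not_le)+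
    qed
    then show False using ne h0 by (simp add: disc_lap_def)
  qed
qed

text \<open>The heart of the proof, on a grid with \<open>N = 2 M + 1\<close> points per period. Here \<open>A\<close> is the sum of \<open>h\<close>
  over the grid, and the nodes \<open>p i / N\<close> are grid points. Evaluate
  \<open>T = (\<Sum>n. disc_symbol n * |hhat n|\<^sup>2 * |f n|\<^sup>2)\<close> in two ways. Dropping the frequencies with nonpositive symbol and
  using \<open>|hhat n| \<le> A\<close> bounds \<open>T\<close> above by the right-hand side. By orthogonality, \<open>T\<close> is a double sum over
  nodes of correlations of \<open>q = h + \<kappa> \<Delta>h\<close> with \<open>h\<close> modulo the period; they vanish for different nodes
  by separation, and for equal nodes all terms are nonnegative, so it suffices to keep the one without
  period shift, where \<open>q \<ge> \<theta>\<close> on the support of \<open>h\<close>.\<close>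

lemma discrete_inequality:
  fixes h :: "real ^ 'n \<Rightarrow> real" and p :: "'i \<Rightarrow> real ^ 'n" and u :: "'i \<Rightarrow> complex"
    and M :: nat and R r \<kappa> \<theta> :: real
  defines "N \<equiv> 2 * M + 1"
  defines "A \<equiv> \<Sum>y\<in>int_lattice \<inter> cball 0 (real N * r). h ((1 / real N) *\<^sub>R y)"
  assumes I: "finite I" and p: "\<And>i. i \<in> I \<Longrightarrow> p i \<in> int_lattice"
    and nonneg: "\<And>y. 0 \<le> h y" and supp: "\<And>y. h y \<noteq> 0 \<Longrightarrow> norm y \<le> R"
    and r: "real N * R + 1 \<le> real N * r"
    and \<kappa>: "0 \<le> \<kappa>" and \<theta>: "0 \<le> \<theta>" "\<And>y. norm y \<le> R \<Longrightarrow> \<theta> \<le> h y + \<kappa> * disc_lap (real N) h y"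
    and sep: "\<And>i j k. i \<in> I \<Longrightarrow> j \<in> I \<Longrightarrow> i \<noteq> j \<Longrightarrow> k \<in> int_lattice \<Longrightarrow>
      norm (p i - p j + real N *\<^sub>R k) > 2 * real N * R + 1"
  shows "\<theta> * real N ^ CARD('n) * A * (\<Sum>i\<in>I. (cmod (u i))\<^sup>2) \<le>
    A\<^sup>2 * (\<Sum>n\<in>{n \<in> freq_box M. disc_symbol \<kappa> (real N) n > 0}.
      (cmod (\<Sum>i\<in>I. u i * char_exp n ((1 / real N) *\<^sub>R p i)))\<^sup>2)"
proof -
  let ?K = "int_lattice \<inter> cball (0 :: real ^ 'n) (real N * r)"
  let ?T = "grid_transform r (real N)"
  have N: "real N > 0" by (simp add: N_def)
  have finK: "finite ?K" by (rule finite_lattice_cball)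
  define q where "q y = h y + \<kappa> * disc_lap (real N) h y" for y
  have q0: "0 \<le> q y" for y
  proof (cases "norm y \<le> R")
    case True
    then show ?thesis using \<theta>(1) \<theta>(2)[OF True] by (simp add: q_def)
  next
    case False
    then show ?thesis using disc_lap_facts(1)[where y = y, OF N nonneg supp] nonneg[of y] \<kappa> by (simp add: q_def)
  qed
  have qsupp: "norm y \<le> R + 1 / real N" if "q y \<noteq> 0" for y
  proof (cases "norm y \<le> R")
    case True
    then show ?thesis using N by (simp add: add_increasing2)
  next
    case False
    then have "h y = 0" using supp by blast
    then have "disc_lap (real N) h y \<noteq> 0" using that by (auto simp: q_def)
    then show ?thesis using disc_lap_facts(2)[where y = y, OF N nonneg supp] False by auto
  qed
  define f where "f n = (\<Sum>i\<in>I. u i * char_exp n ((1 / real N) *\<^sub>R p i))" for n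
  define T where "T = (\<Sum>n\<in>freq_box M. disc_symbol \<kappa> (real N) n * ((cmod (?T h n))\<^sup>2 * (cmod (f n))\<^sup>2))"
  \<comment> \<open>\<open>w\<close> detects the period lattice, and \<open>W i j\<close> is the periodic correlation of the translates at \<open>i\<close> and \<open>j\<close>.\<close>
  define w where "w z = (if \<exists>k\<in>int_lattice. z = real N *\<^sub>R k then 1 else 0 :: real)" for z :: "real ^ 'n"
  define W where "W i j = (\<Sum>(y, y')\<in>?K \<times> ?K. q ((1 / real N) *\<^sub>R y) * h ((1 / real N) *\<^sub>R y') * w (p i - p j + (y - y')))" for i j
  have TW: "of_real T = (\<Sum>i\<in>I. \<Sum>j\<in>I. u i * cnj (u j) * of_real (real N ^ CARD('n) * W i j))"
  proof -
    have TT: "of_real (disc_symbol \<kappa> (real N) n * (cmod (?T h n))\<^sup>2) =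
        (\<Sum>(y, y')\<in>?K \<times> ?K. of_real (q ((1 / real N) *\<^sub>R y) * h ((1 / real N) *\<^sub>R y')) * char_exp n ((1 / real N) *\<^sub>R (y - y')))" for n
    proof -
      have "of_real (disc_symbol \<kappa> (real N) n * (cmod (?T h n))\<^sup>2) = ?T q n * cnj (?T h n)"
      proof -
        have "?T q n = of_real (disc_symbol \<kappa> (real N) n) * ?T h n"
          unfolding q_def by (rule grid_transform_laplacian[OF N supp r])
        then show ?thesis
          unfolding of_real_mult complex_norm_square by (simp only: mult.assoc)
      qed
      also have "\<dots> = (\<Sum>y\<in>?K. \<Sum>y'\<in>?K. of_real (q ((1 / real N) *\<^sub>R y) * h ((1 / real N) *\<^sub>R y')) * char_exp n ((1 / real N) *\<^sub>R (y - y')))"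
        unfolding grid_transform_def cnj_sum sum_product scaleR_diff_right char_exp_diff
        by (simp add: mult_ac)
      finally show ?thesis by (simp add: sum.cartesian_product)
    qed
    have ff: "of_real ((cmod (f n))\<^sup>2) = (\<Sum>(i, j)\<in>I \<times> I. u i * cnj (u j) * char_exp n ((1 / real N) *\<^sub>R (p i - p j)))" for n
      unfolding complex_norm_square f_def cnj_sum sum_product sum.cartesian_product scaleR_diff_right char_exp_diff
      by (simp add: mult_ac case_prod_unfold)
    have orth: "(\<Sum>n\<in>freq_box M. char_exp n ((1 / real N) *\<^sub>R z)) = of_real (real N ^ CARD('n) * w z)"
      if "z \<in> int_lattice" for z :: "real ^ 'n"
      using freq_box_orthogonality[OF that, of M] by (simp add: w_def N_def)
    have "complex_of_real T = (\<Sum>n\<in>freq_box M. of_real ((cmod (f n))\<^sup>2) * of_real (disc_symbol \<kappa> (real N) n * (cmod (?T h n))\<^sup>2))"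
      unfolding T_def of_real_sum by (simp add: mult_ac)
    also have "\<dots> = (\<Sum>n\<in>freq_box M. \<Sum>s\<in>I \<times> I. \<Sum>t\<in>?K \<times> ?K.
        (u (fst s) * cnj (u (snd s))) * of_real (q ((1 / real N) *\<^sub>R fst t) * h ((1 / real N) *\<^sub>R snd t)) *
        char_exp n ((1 / real N) *\<^sub>R (p (fst s) - p (snd s) + (fst t - snd t))))"
      unfolding TT ff sum_product scaleR_add_right char_exp_add case_prod_unfold
      by (simp only: mult_ac)
    also have "\<dots> = (\<Sum>s\<in>I \<times> I. \<Sum>t\<in>?K \<times> ?K. \<Sum>n\<in>freq_box M.
        (u (fst s) * cnj (u (snd s))) * of_real (q ((1 / real N) *\<^sub>R fst t) * h ((1 / real N) *\<^sub>R snd t)) *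
        char_exp n ((1 / real N) *\<^sub>R (p (fst s) - p (snd s) + (fst t - snd t))))"
      unfolding sum.swap[of _ _ "freq_box M"] ..
    also have "\<dots> = (\<Sum>s\<in>I \<times> I. \<Sum>t\<in>?K \<times> ?K.
        (u (fst s) * cnj (u (snd s))) * of_real (q ((1 / real N) *\<^sub>R fst t) * h ((1 / real N) *\<^sub>R snd t)) *
        of_real (real N ^ CARD('n) * w (p (fst s) - p (snd s) + (fst t - snd t))))"
      unfolding sum_distrib_left[symmetric]
      by (intro sum.cong refl arg_cong2[of _ _ _ _ times] orth int_lattice_add int_lattice_diff p) auto
    also have "\<dots> = (\<Sum>s\<in>I \<times> I. u (fst s) * cnj (u (snd s)) * of_real (real N ^ CARD('n) * W (fst s) (snd s)))"
      unfolding W_def case_prod_unfold of_real_mult of_real_sum sum_distrib_left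
      by (simp only: mult_ac)
    finally show ?thesis by (simp add: sum.cartesian_product case_prod_unfold)
  qed
  have off: "W i j = 0" if ij: "i \<in> I" "j \<in> I" "i \<noteq> j" for i j
    unfolding W_def
  proof (rule sum.neutral, clarify, rule ccontr)
    fix y y' :: "real ^ 'n" assume K: "y \<in> int_lattice" "y' \<in> int_lattice"
    assume ne: "q ((1 / real N) *\<^sub>R y) * h ((1 / real N) *\<^sub>R y') * w (p i - p j + (y - y')) \<noteq> 0"
    then have "norm ((1 / real N) *\<^sub>R y) \<le> R + 1 / real N" "norm ((1 / real N) *\<^sub>R y') \<le> R"
      using qsupp[of "(1 / real N) *\<^sub>R y"] supp[of "(1 / real N) *\<^sub>R y'"] by auto
    then have "norm y \<le> real N * R + 1" "norm y' \<le> real N * R" using N by (simp_all add: field_simps)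
    then have yy: "norm (y' - y) \<le> 2 * real N * R + 1" using norm_triangle_ineq4[of y' y] by simp
    from ne obtain k where k: "k \<in> int_lattice" "p i - p j + (y - y') = real N *\<^sub>R k"
      by (auto simp: w_def split: if_splits)
    then have "p i - p j + real N *\<^sub>R (- k) = y' - y" by (simp add: algebra_simps)
    then show False using sep[OF ij int_lattice_uminus[OF k(1)]] yy by simp
  qed
  have diag: "\<theta> * A \<le> W i i" if "i \<in> I" for i
  proof -
    have "\<theta> * A = (\<Sum>y\<in>?K. \<theta> * h ((1 / real N) *\<^sub>R y))" by (simp add: A_def sum_distrib_left)
    also have "\<dots> \<le> (\<Sum>y\<in>?K. q ((1 / real N) *\<^sub>R y) * h ((1 / real N) *\<^sub>R y) * w (p i - p i + (y - y)))"
    proof (rule sum_mono)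
      fix y
      have "w 0 = 1" using int_lattice_zero by (auto simp: w_def intro!: bexI[of _ 0])
      moreover have "\<theta> * h ((1 / real N) *\<^sub>R y) \<le> q ((1 / real N) *\<^sub>R y) * h ((1 / real N) *\<^sub>R y)"
      proof (cases "h ((1 / real N) *\<^sub>R y) = 0")
        case False
        then show ?thesis using \<theta>(2) supp nonneg unfolding q_def by (intro mult_right_mono) auto
      qed simp
      ultimately show "\<theta> * h ((1 / real N) *\<^sub>R y) \<le> q ((1 / real N) *\<^sub>R y) * h ((1 / real N) *\<^sub>R y) * w (p i - p i + (y - y))"
        by simp
    qed
    also have "\<dots> \<le> (\<Sum>y\<in>?K. \<Sum>y'\<in>?K. q ((1 / real N) *\<^sub>R y) * h ((1 / real N) *\<^sub>R y') * w (p i - p i + (y - y')))"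
      by (intro sum_mono member_le_sum finK) (auto simp: q0 nonneg w_def)
    also have "\<dots> = W i i" unfolding W_def by (simp add: sum.cartesian_product)
    finally show ?thesis .
  qed
  have "of_real T = complex_of_real (\<Sum>i\<in>I. (cmod (u i))\<^sup>2 * (real N ^ CARD('n) * W i i))"
  proof -
    have "(\<Sum>j\<in>I. u i * cnj (u j) * of_real (real N ^ CARD('n) * W i j)) =
        of_real ((cmod (u i))\<^sup>2 * (real N ^ CARD('n) * W i i))" if i: "i \<in> I" for i
    proof -
      have "(\<Sum>j\<in>I. u i * cnj (u j) * of_real (real N ^ CARD('n) * W i j)) =
          (\<Sum>j\<in>{i}. u i * cnj (u j) * of_real (real N ^ CARD('n) * W i j))"
        by (rule sum.mono_neutral_right) (use I i off in auto)
      then show ?thesis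
        unfolding of_real_mult[of "(cmod (u i))\<^sup>2"] complex_norm_square by simp
    qed
    then show ?thesis unfolding TW by simp
  qed
  then have T: "T = (\<Sum>i\<in>I. (cmod (u i))\<^sup>2 * (real N ^ CARD('n) * W i i))"
    by (simp only: of_real_eq_iff)
  have "\<theta> * real N ^ CARD('n) * A * (\<Sum>i\<in>I. (cmod (u i))\<^sup>2) =
      (\<Sum>i\<in>I. (cmod (u i))\<^sup>2 * (real N ^ CARD('n) * (\<theta> * A)))"
    by (simp add: sum_distrib_left mult_ac)
  also have "\<dots> \<le> T"
    unfolding T by (intro sum_mono mult_left_mono diag) auto
  also have "T \<le> (\<Sum>n\<in>{n \<in> freq_box M. disc_symbol \<kappa> (real N) n > 0}. A\<^sup>2 * (cmod (f n))\<^sup>2)"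
  proof -
    have TA: "(cmod (?T h n))\<^sup>2 \<le> A\<^sup>2" for n
    proof (rule power_mono)
      have "cmod (?T h n) \<le> (\<Sum>y\<in>?K. cmod (of_real (h ((1 / real N) *\<^sub>R y)) * char_exp n ((1 / real N) *\<^sub>R y)))"
        unfolding grid_transform_def by (rule norm_sum)
      also have "\<dots> = A" by (simp add: A_def norm_mult norm_char_exp nonneg)
      finally show "cmod (?T h n) \<le> A" .
    qed simp
    have sy: "disc_symbol \<kappa> (real N) n \<le> 1" for n :: "real ^ 'n"
      using \<kappa> by (simp add: disc_symbol_def sum_nonneg)
    have "T \<le> (\<Sum>n\<in>freq_box M. if disc_symbol \<kappa> (real N) n > 0 then A\<^sup>2 * (cmod (f n))\<^sup>2 else 0)"
      unfolding T_def
    proof (rule sum_mono)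
      fix n :: "real ^ 'n"
      show "disc_symbol \<kappa> (real N) n * ((cmod (?T h n))\<^sup>2 * (cmod (f n))\<^sup>2)
        \<le> (if disc_symbol \<kappa> (real N) n > 0 then A\<^sup>2 * (cmod (f n))\<^sup>2 else 0)"
      proof (cases "disc_symbol \<kappa> (real N) n > 0")
        case True
        have "disc_symbol \<kappa> (real N) n * ((cmod (?T h n))\<^sup>2 * (cmod (f n))\<^sup>2) \<le> 1 * (A\<^sup>2 * (cmod (f n))\<^sup>2)"
          using True sy TA by (intro mult_mono mult_right_mono) auto
        then show ?thesis using True by simp
      next
        case False
        then show ?thesis by (simp add: mult_nonpos_nonneg)
      qed
    qed
    also have "\<dots> = (\<Sum>n\<in>{n \<in> freq_box M. disc_symbol \<kappa> (real N) n > 0}. A\<^sup>2 * (cmod (f n))\<^sup>2)"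
      by (rule sum.inter_filter[OF finite_freq_box, symmetric])
    finally show ?thesis .
  qed
  finally show ?thesis by (simp add: f_def sum_distrib_left)
qed

section \<open>Refining the grid\<close>

text \<open>With \<open>y = x / 2 \<le> pi / 4\<close>, both \<open>cos y\<close> and, by the mean value theorem, \<open>sin y / y\<close> are at least
  \<open>cos (pi / 4)\<close>, and \<open>sin x = 2 sin y cos y\<close>.\<close>

lemma sin_ge_half:
  assumes "0 \<le> x" "x \<le> pi / 2"
  shows "x / 2 \<le> sin (x :: real)"
proof -
  define y where "y = x / 2"
  have y: "0 \<le> y" "y \<le> pi / 4" using assms by (simp_all add: y_def)
  have c: "sqrt 2 / 2 \<le> cos z" if "0 \<le> z" "z \<le> pi / 4" for z
    using cos_monotone_0_pi_le[of z "pi / 4"] that by (simp add: cos_45)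
  have "sin y \<ge> y * (sqrt 2 / 2)"
  proof (cases "y = 0")
    case False
    then obtain z where "0 < z" "z < y" "sin y - sin 0 = (y - 0) * cos z"
      using MVT2[of 0 y sin cos] y by auto
    then show ?thesis using c[of z] y by (simp add: mult_left_mono)
  qed simp
  then have "2 * (y * (sqrt 2 / 2)) * (sqrt 2 / 2) \<le> 2 * sin y * cos y"
    using c[OF y] y pi_gt_zero by (intro mult_mono) (auto intro!: mult_nonneg_nonneg sin_ge_zero)
  also have "2 * sin y * cos y = sin x" by (simp add: y_def sin_double[symmetric])
  finally have "y * (sqrt 2 * sqrt 2) \<le> 2 * sin x" by (simp add: mult_ac)
  then show ?thesis by (simp add: y_def)
qed

lemma sin_squared_ge:
  assumes "\<bar>x\<bar> \<le> pi / 2"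
  shows "x\<^sup>2 / 4 \<le> (sin x)\<^sup>2"
proof -
  have "\<bar>x\<bar> / 2 \<le> sin \<bar>x\<bar>" using assms by (intro sin_ge_half) auto
  then have "(\<bar>x\<bar> / 2)\<^sup>2 \<le> (sin \<bar>x\<bar>)\<^sup>2" by (intro power_mono) auto
  then show ?thesis by (simp add: power_divide abs_if split: if_splits)
qed

lemma N_sin_tendsto:
  "(\<lambda>N. real N * sin (pi * a / real N)) \<longlonglongrightarrow> pi * a"
proof (cases "a = 0")
  case False
  have "((\<lambda>x. sin x / x) \<longlongrightarrow> 1) (at (0 :: real))"
    using DERIV_sin[of "0 :: real"] by (simp add: DERIV_def)
  moreover have "filterlim (\<lambda>N. pi * a / real N) (at 0) sequentially"
    unfolding filterlim_at using False eventually_gt_at_top[of 0]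
    by (auto intro: lim_const_over_n elim!: eventually_mono)
  ultimately have "(\<lambda>N. sin (pi * a / real N) / (pi * a / real N)) \<longlonglongrightarrow> 1"
    by (rule filterlim_compose)
  from tendsto_mult_left[OF this, of "pi * a"] show ?thesis
    using False by (simp add: field_simps)
qed simp

text \<open>The symbol converges to \<open>1 - |n|\<^sup>2 / m\<^sup>2\<close> for each fixed \<open>n\<close>, but not uniformly in \<open>n\<close>. The crude bound
  \<open>|sin x| \<ge> |x| / 2\<close> on \<open>|x| \<le> pi / 2\<close> first confines positivity to \<open>|n| \<le> 2 m\<close>; among these finitely many
  frequencies pointwise convergence is enough.\<close>

lemma eventually_symbol_nonpos:
  fixes m :: real
  assumes m: "m > 0"
  shows "\<forall>\<^sub>F M in sequentially. \<forall>n :: real ^ 'n \<in> freq_box M.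
    disc_symbol (1 / (4 * pi\<^sup>2 * m\<^sup>2)) (real (2 * M + 1)) n > 0 \<longrightarrow> norm n \<le> m"
proof -
  define \<sigma> where "\<sigma> N n = (\<Sum>j\<in>UNIV. (real N * sin (pi * n $ j / real N))\<^sup>2)" for N and n :: "real ^ 'n"
  have sym: "disc_symbol (1 / (4 * pi\<^sup>2 * m\<^sup>2)) (real N) n > 0 \<longleftrightarrow> \<sigma> N n < pi\<^sup>2 * m\<^sup>2" for N and n :: "real ^ 'n"
    using m by (simp add: disc_symbol_def \<sigma>_def power_mult_distrib sum_distrib_left[symmetric] field_simps)
  have lim: "(\<lambda>N. \<sigma> N n) \<longlonglongrightarrow> pi\<^sup>2 * (norm n)\<^sup>2" for n :: "real ^ 'n"
  proof -
    have "(\<lambda>N. \<sigma> N n) \<longlonglongrightarrow> (\<Sum>j\<in>UNIV. (pi * n $ j)\<^sup>2)"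
      unfolding \<sigma>_def by (intro tendsto_sum tendsto_power N_sin_tendsto)
    also have "(\<Sum>j\<in>UNIV. (pi * n $ j)\<^sup>2) = pi\<^sup>2 * (norm n)\<^sup>2"
      by (simp add: power_mult_distrib sum_distrib_left[symmetric] norm_vec_def L2_set_def sum_nonneg)
    finally show ?thesis .
  qed
  have sub: "filterlim (\<lambda>M. 2 * M + 1 :: nat) sequentially sequentially"
    by (rule filterlim_subseq) (simp add: strict_mono_def)
  define K where "K = {n :: real ^ 'n \<in> int_lattice \<inter> cball 0 (2 * m). norm n > m}"
  have "finite K"
    by (rule finite_subset[OF _ finite_lattice_cball[of "2 * m"]]) (auto simp: K_def)
  then have "\<forall>\<^sub>F M in sequentially. \<forall>n\<in>K. \<sigma> (2 * M + 1) n > pi\<^sup>2 * m\<^sup>2"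
  proof (rule eventually_ball_finite, intro ballI)
    fix n assume "n \<in> K"
    then have "m\<^sup>2 < (norm n)\<^sup>2" using m by (intro power_strict_mono) (auto simp: K_def)
    then have "pi\<^sup>2 * m\<^sup>2 < pi\<^sup>2 * (norm n)\<^sup>2" by simp
    from order_tendstoD(1)[OF filterlim_compose[OF lim sub] this]
    show "\<forall>\<^sub>F M in sequentially. \<sigma> (2 * M + 1) n > pi\<^sup>2 * m\<^sup>2" .
  qed
  then show ?thesis
  proof eventually_elim
    case (elim M)
    show ?case
    proof (intro ballI impI, rule ccontr)
      fix n :: "real ^ 'n"
      assume n: "n \<in> freq_box M" and pos: "disc_symbol (1 / (4 * pi\<^sup>2 * m\<^sup>2)) (real (2 * M + 1)) n > 0"
        and far: "\<not> norm n \<le> m"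
      let ?N = "2 * M + 1"
      have lt: "\<sigma> ?N n < pi\<^sup>2 * m\<^sup>2" using pos sym by blast
      have "(pi * n $ j)\<^sup>2 / 4 \<le> (real ?N * sin (pi * n $ j / real ?N))\<^sup>2" for j
      proof -
        have "\<bar>n $ j\<bar> \<le> real M" using n by (simp add: freq_box_def)
        then have "\<bar>n $ j\<bar> / real ?N \<le> 1 / 2" by (simp add: field_simps)
        then have "pi * (\<bar>n $ j\<bar> / real ?N) \<le> pi * (1 / 2)" by (intro mult_left_mono) auto
        then have "\<bar>pi * n $ j / real ?N\<bar> \<le> pi / 2" by (simp add: abs_mult)
        from sin_squared_ge[OF this] have "(real ?N)\<^sup>2 * ((pi * n $ j / real ?N)\<^sup>2 / 4) \<le> (real ?N)\<^sup>2 * (sin (pi * n $ j / real ?N))\<^sup>2"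
          by (rule mult_left_mono) simp
        then show ?thesis by (simp add: power_mult_distrib power_divide)
      qed
      then have "(\<Sum>j\<in>UNIV. (pi * n $ j)\<^sup>2 / 4) \<le> \<sigma> ?N n" unfolding \<sigma>_def by (rule sum_mono)
      also have "(\<Sum>j\<in>UNIV. (pi * n $ j)\<^sup>2 / 4) = pi\<^sup>2 * (norm n)\<^sup>2 / 4"
        by (simp add: power_mult_distrib sum_distrib_left[symmetric] sum_divide_distrib[symmetric] norm_vec_def L2_set_def sum_nonneg)
      finally have "pi\<^sup>2 * (norm n)\<^sup>2 / 4 < pi\<^sup>2 * m\<^sup>2" using lt by (rule le_less_trans)
      then have "pi\<^sup>2 * ((norm n)\<^sup>2 / 4) < pi\<^sup>2 * m\<^sup>2" by simp
      then have "(norm n)\<^sup>2 / 4 < m\<^sup>2" by (rule mult_left_less_imp_less) simp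
      then have "(norm n)\<^sup>2 \<le> (2 * m)\<^sup>2" by (simp add: power_mult_distrib)
      then have "norm n \<le> 2 * m" by (rule power2_le_imp_le) (use m in simp)
      then have "n \<in> K" using n far by (simp add: K_def freq_box_def)
      then show False using elim lt by fastforce
    qed
  qed
qed

text \<open>The limit of the discrete inequality for an arbitrary profile \<open>h\<close>. The nodes are rounded down to the
  grid, which moves each of them by at most \<open>d / N\<close>; the surplus \<open>\<delta>\<close> in the separation absorbs this and the
  extra grid step in the support of \<open>h + \<kappa> \<Delta>h\<close>.\<close>

lemma sum_squares_le_of_profile:
  fixes h :: "real ^ 'n \<Rightarrow> real" and p :: "'i \<Rightarrow> real ^ 'n" and u :: "'i \<Rightarrow> complex"
  assumes m: "m > 0" and I: "finite I"
    and nonneg: "\<And>y. 0 \<le> h y" and supp: "\<And>y. h y \<noteq> 0 \<Longrightarrow> norm y \<le> R"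
    and near: "\<And>\<epsilon>. \<epsilon> > 0 \<Longrightarrow> \<forall>\<^sub>F N in sequentially. \<forall>y. norm y \<le> R \<longrightarrow>
      1 - \<epsilon> \<le> h y + 1 / (4 * pi\<^sup>2 * m\<^sup>2) * disc_lap (real N) h y"
    and J: "(\<lambda>N. (1 / real N) ^ CARD('n) * (\<Sum>k\<in>int_lattice \<inter> cball 0 (real N * (R + 1)). h ((1 / real N) *\<^sub>R k))) \<longlonglongrightarrow> J"
    and J0: "J > 0" and \<delta>: "\<delta> > 0"
    and sep: "\<And>i j k. i \<in> I \<Longrightarrow> j \<in> I \<Longrightarrow> i \<noteq> j \<Longrightarrow> k \<in> int_lattice \<Longrightarrow> norm (p i - p j + k) \<ge> 2 * R + \<delta>"
  shows "(\<Sum>i\<in>I. (cmod (u i))\<^sup>2) \<le>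
    J * (\<Sum>n\<in>int_lattice \<inter> cball 0 m. (cmod (\<Sum>i\<in>I. u i * char_exp n (p i)))\<^sup>2)"
proof (rule field_le_mult_one_interval)
  fix \<theta> :: real assume \<theta>: "0 < \<theta>" "\<theta> < 1"
  define \<kappa> where "\<kappa> = 1 / (4 * pi\<^sup>2 * m\<^sup>2)"
  define U where "U = (\<Sum>i\<in>I. (cmod (u i))\<^sup>2)"
  define A where "A N = (\<Sum>k\<in>int_lattice \<inter> cball 0 (real N * (R + 1)). h ((1 / real N) *\<^sub>R k))" for N
  define P where "P N i = grid_floor (real N *\<^sub>R p i)" for N i
  define S where "S N = (\<Sum>n\<in>int_lattice \<inter> cball 0 m. (cmod (\<Sum>i\<in>I. u i * char_exp n ((1 / real N) *\<^sub>R P N i)))\<^sup>2)" for N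
  have fin: "finite (int_lattice \<inter> cball (0 :: real ^ 'n) m)" by (rule finite_lattice_cball)
  have sub: "filterlim (\<lambda>M. 2 * M + 1 :: nat) sequentially sequentially"
    by (rule filterlim_subseq) (simp add: strict_mono_def)
  have evsub: "\<forall>\<^sub>F M in sequentially. Q (2 * M + 1)" if "\<forall>\<^sub>F N in sequentially. Q N" for Q :: "nat \<Rightarrow> bool"
    using sub that by (rule eventually_compose_filterlim[rotated])
  have Jlim: "(\<lambda>N. (1 / real N) ^ CARD('n) * A N) \<longlonglongrightarrow> J" unfolding A_def by (rule J)
  have Slim: "S \<longlonglongrightarrow> (\<Sum>n\<in>int_lattice \<inter> cball 0 m. (cmod (\<Sum>i\<in>I. u i * char_exp n (p i)))\<^sup>2)"
    unfolding S_def P_def char_exp_def by (intro tendsto_intros grid_floor_tendsto)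
  have "\<forall>\<^sub>F N in sequentially. (1 / real N) ^ CARD('n) * A N > 0"
    by (rule order_tendstoD(1)[OF Jlim J0])
  then have e1: "\<forall>\<^sub>F N in sequentially. A N > 0"
    by eventually_elim (auto simp: zero_less_mult_iff zero_less_divide_iff power_less_zero_eq)
  have e2: "\<forall>\<^sub>F N in sequentially. \<forall>y. norm y \<le> R \<longrightarrow> \<theta> \<le> h y + \<kappa> * disc_lap (real N) h y"
    using near[of "1 - \<theta>"] \<theta> by (simp add: \<kappa>_def)
  have e3: "\<forall>\<^sub>F N in sequentially. real N * \<delta> > 2 * real CARD('n) + 1"
  proof -
    have "filterlim (\<lambda>N. real N * \<delta>) at_top sequentially"
      using \<delta> by (intro filterlim_at_top_mult_tendsto_pos[OF tendsto_const] filterlim_real_sequentially)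
    then show ?thesis by (simp add: filterlim_at_top_dense)
  qed
  have "\<forall>\<^sub>F M in sequentially. \<theta> * U \<le> (1 / real (2 * M + 1)) ^ CARD('n) * A (2 * M + 1) * S (2 * M + 1)"
    using evsub[OF e1] evsub[OF e2] evsub[OF e3] eventually_symbol_nonpos[OF m, where 'n = 'n]
  proof eventually_elim
    case (elim M)
    define N where "N = 2 * M + 1"
    have N: "real N > 0" by (simp add: N_def)
    have "\<theta> * real N ^ CARD('n) * A N * U \<le> (A N)\<^sup>2 *
        (\<Sum>n\<in>{n \<in> freq_box M. disc_symbol \<kappa> (real N) n > 0}. (cmod (\<Sum>i\<in>I. u i * char_exp n ((1 / real N) *\<^sub>R P N i)))\<^sup>2)"
      unfolding U_def A_def N_def
    proof (rule discrete_inequality[where R = R, OF I])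
      show "real (2 * M + 1) * R + 1 \<le> real (2 * M + 1) * (R + 1)" by (simp add: algebra_simps)
      show "\<theta> \<le> h y + \<kappa> * disc_lap (real (2 * M + 1)) h y" if "norm y \<le> R" for y using elim(2) that by blast
      show "P (2 * M + 1) i \<in> int_lattice" for i by (simp add: P_def grid_floor_lattice)
      fix i j k assume ij: "i \<in> I" "j \<in> I" "i \<noteq> j" "k \<in> (int_lattice :: (real ^ 'n) set)"
      have "real N * (2 * R + \<delta>) \<le> real N * norm (p i - p j + k)"
        using sep[OF ij] N by (intro mult_left_mono) auto
      also have "\<dots> = norm ((P N i - P N j + real N *\<^sub>R k) - (P N i - real N *\<^sub>R p i) + (P N j - real N *\<^sub>R p j))"
      proof -
        have "(P N i - P N j + real N *\<^sub>R k) - (P N i - real N *\<^sub>R p i) + (P N j - real N *\<^sub>R p j) =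
            real N *\<^sub>R (p i - p j + k)" by (simp add: algebra_simps)
        then show ?thesis by simp
      qed
      also have "\<dots> \<le> norm (P N i - P N j + real N *\<^sub>R k) + norm (P N i - real N *\<^sub>R p i) + norm (P N j - real N *\<^sub>R p j)"
        by (meson norm_triangle_ineq norm_triangle_ineq4 order_trans add_right_mono)
      also have "\<dots> \<le> norm (P N i - P N j + real N *\<^sub>R k) + real CARD('n) + real CARD('n)"
        unfolding P_def by (intro add_mono norm_grid_floor_diff order_refl)
      finally show "norm (P (2 * M + 1) i - P (2 * M + 1) j + real (2 * M + 1) *\<^sub>R k) > 2 * real (2 * M + 1) * R + 1"
        using elim(3) unfolding N_def[symmetric] by (simp add: algebra_simps)
    qed (use nonneg supp \<theta> in \<open>auto simp: \<kappa>_def\<close>)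
    also have "\<dots> \<le> (A N)\<^sup>2 * S N"
      unfolding S_def
      by (intro mult_left_mono sum_mono2 fin) (use elim(4) in \<open>auto simp: freq_box_def N_def \<kappa>_def\<close>)
    finally have "A N * (\<theta> * real N ^ CARD('n) * U) \<le> A N * (A N * S N)"
      by (simp add: power2_eq_square mult_ac)
    then have "\<theta> * real N ^ CARD('n) * U \<le> A N * S N"
      using elim(1) by (simp add: N_def)
    then have "(1 / real N) ^ CARD('n) * (\<theta> * real N ^ CARD('n) * U) \<le> (1 / real N) ^ CARD('n) * (A N * S N)"
      using N by (intro mult_left_mono) auto
    also have "(1 / real N) ^ CARD('n) * (\<theta> * real N ^ CARD('n) * U) = \<theta> * U"
      using N by (simp add: power_divide)
    finally show ?case by (simp only: N_def mult.assoc)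
  qed
  moreover have "(\<lambda>M. (1 / real (2 * M + 1)) ^ CARD('n) * A (2 * M + 1) * S (2 * M + 1)) \<longlonglongrightarrow>
      J * (\<Sum>n\<in>int_lattice \<inter> cball 0 m. (cmod (\<Sum>i\<in>I. u i * char_exp n (p i)))\<^sup>2)"
    by (rule filterlim_compose[OF tendsto_mult[OF Jlim Slim] sub])
  ultimately show "\<theta> * U \<le> J * (\<Sum>n\<in>int_lattice \<inter> cball 0 m. (cmod (\<Sum>i\<in>I. u i * char_exp n (p i)))\<^sup>2)"
    by (intro tendsto_lowerbound[OF _ _ sequentially_bot])
qed

section \<open>The radial profile and its discrete Laplacian\<close>

lemma emeasure_lborel_cball_Int_norm_gt:
  fixes R x :: real
  assumes "0 \<le> R"
  shows "emeasure lborel (cball (0 :: 'a :: euclidean_space) R \<inter> {y. x < norm y}) =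
    ennreal (unit_ball_vol (real DIM('a)) * (R ^ DIM('a) - (max 0 (min x R)) ^ DIM('a)))"
proof (cases "0 \<le> x \<and> x \<le> R")
  case True
  have eq: "cball (0 :: 'a) R \<inter> {y. x < norm y} = cball 0 R - cball 0 x" by auto
  have "emeasure lborel (cball (0 :: 'a) R - cball 0 x) =
      emeasure lborel (cball (0 :: 'a) R) - emeasure lborel (cball (0 :: 'a) x)"
    by (rule emeasure_Diff) (use True in \<open>auto simp: emeasure_cball\<close>)
  also have "\<dots> = ennreal (unit_ball_vol (real DIM('a)) * R ^ DIM('a) - unit_ball_vol (real DIM('a)) * x ^ DIM('a))"
    using True assms by (simp add: emeasure_cball ennreal_minus)
  finally show ?thesis using True eq by (simp add: algebra_simps)
next
  case False
  show ?thesis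
  proof (cases "x < 0")
    case True
    then have "cball (0 :: 'a) R \<inter> {y. x < norm y} = cball 0 R"
      by (auto intro: less_le_trans)
    then show ?thesis using True assms by (simp add: emeasure_cball)
  next
    case x: False
    then have "cball (0 :: 'a) R \<inter> {y. x < norm y} = {}" using False by auto
    then show ?thesis using x False assms by simp
  qed
qed

text \<open>Integration in polar coordinates. Both sides are integrals of \<open>g\<close> against measures on the line, and these
  measures agree on all rays because the volume of a ball of radius \<open>x\<close> is proportional to \<open>x\<^sup>d\<close>.\<close>

lemma integral_cball_radial:
  fixes g :: "real \<Rightarrow> real"
  assumes R: "0 \<le> R" and g: "g \<in> borel_measurable borel"
  shows "(\<integral>x. indicator (cball (0 :: 'a :: euclidean_space) R) x * g (norm x) \<partial>lborel) =
    (\<integral>r. real DIM('a) * unit_ball_vol (real DIM('a)) * r ^ (DIM('a) - 1) * g r * indicator {0..R} r \<partial>lborel)"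
proof -
  define v where "v = unit_ball_vol (real DIM('a))"
  define w where "w r = real DIM('a) * v * r ^ (DIM('a) - 1) * indicator {0..R} r" for r :: real
  have v: "v \<ge> 0" by (simp add: v_def)
  have w: "w r \<ge> 0" for r using v by (auto simp: w_def indicator_def)
  have wm [measurable]: "w \<in> borel_measurable borel" unfolding w_def by measurable
  note g [measurable]
  define M where "M = distr (density lborel (\<lambda>x :: 'a. ennreal (indicator (cball 0 R) x))) borel norm"
  define N where "N = density lborel (\<lambda>r. ennreal (w r))"
  have eM: "emeasure M {x<..} = ennreal (v * (R ^ DIM('a) - (max 0 (min x R)) ^ DIM('a)))" for x
  proof -
    have "emeasure M {x<..} = (\<integral>\<^sup>+y. ennreal (indicator (cball (0 :: 'a) R) y) * indicator {y. x < norm y} y \<partial>lborel)"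
    proof -
      have "open {y :: 'a. x < norm y}" by (intro open_Collect_less continuous_intros)
      then have "{y :: 'a. x < norm y} \<in> sets lborel" by simp
      moreover have "emeasure M {x<..} =
          emeasure (density lborel (\<lambda>x :: 'a. ennreal (indicator (cball 0 R) x))) {y. x < norm y}"
        unfolding M_def by (subst emeasure_distr) (simp_all add: vimage_def)
      ultimately show ?thesis
        by (subst (asm) emeasure_density) (simp_all add: borel_measurable_indicator)
    qed
    also have "\<dots> = (\<integral>\<^sup>+y. indicator (cball (0 :: 'a) R \<inter> {y. x < norm y}) y \<partial>lborel)"
      by (intro nn_integral_cong) (auto simp: indicator_def)
    also have "\<dots> = emeasure lborel (cball (0 :: 'a) R \<inter> {y. x < norm y})"
      by (rule nn_integral_indicator) measurable
    finally show ?thesis unfolding v_def emeasure_lborel_cball_Int_norm_gt[OF R] .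
  qed
  have eN: "emeasure N {x<..} = ennreal (v * (R ^ DIM('a) - (max 0 (min x R)) ^ DIM('a)))" for x
  proof -
    define a where "a = max 0 (min x R)"
    have "emeasure N {x<..} = (\<integral>\<^sup>+r. ennreal (w r) * indicator {x<..} r \<partial>lborel)"
      unfolding N_def by (subst emeasure_density) auto
    also have "\<dots> = (\<integral>\<^sup>+r. ennreal (real DIM('a) * v * r ^ (DIM('a) - 1)) * indicator {a..R} r \<partial>lborel)"
    proof (rule nn_integral_cong_AE)
      show "AE r in lborel. ennreal (w r) * indicator {x<..} r =
          ennreal (real DIM('a) * v * r ^ (DIM('a) - 1)) * indicator {a..R} r"
        using AE_lborel_singleton[of x] AE_lborel_singleton[of R]
        by eventually_elim (use R in \<open>auto simp: w_def indicator_def a_def\<close>)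
    qed
    also have "\<dots> = v * R ^ DIM('a) - v * a ^ DIM('a)"
    proof (rule nn_integral_FTC_Icc)
      show "a \<le> R" using R by (simp add: a_def)
      fix r assume "r \<in> {a..R}"
      then have "0 \<le> r" by (simp add: a_def)
      then show "0 \<le> real DIM('a) * v * r ^ (DIM('a) - 1)" using v by simp
      show "((\<lambda>r. v * r ^ DIM('a)) has_real_derivative real DIM('a) * v * r ^ (DIM('a) - 1)) (at r)"
        by (auto intro!: derivative_eq_intros)
    qed simp
    finally show ?thesis by (simp add: a_def algebra_simps)
  qed
  have "M = N"
  proof (rule measure_eqI_lessThan)
    show "sets M = sets borel" "sets N = sets borel" by (simp_all add: M_def N_def)
    show "emeasure M {x<..} < \<infinity>" "emeasure M {x<..} = emeasure N {x<..}" for x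
      by (simp_all add: eM eN)
  qed
  have "(\<integral>x. indicator (cball (0 :: 'a) R) x * g (norm x) \<partial>lborel) = integral\<^sup>L M g"
  proof -
    have "integral\<^sup>L M g = (\<integral>x. g (norm x) \<partial>density lborel (\<lambda>x :: 'a. ennreal (indicator (cball 0 R) x)))"
      unfolding M_def by (subst integral_distr) simp_all
    also have "\<dots> = (\<integral>x. indicator (cball (0 :: 'a) R) x *\<^sub>R g (norm x) \<partial>lborel)"
      by (rule integral_density) (simp_all add: borel_measurable_indicator)
    finally show ?thesis by simp
  qed
  also have "\<dots> = (\<integral>r. w r * g r \<partial>lborel)"
    unfolding \<open>M = N\<close> N_def using w by (subst integral_density) simp_all
  also have "\<dots> = (\<integral>r. real DIM('a) * v * r ^ (DIM('a) - 1) * g r * indicator {0..R} r \<partial>lborel)"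
    by (simp add: w_def mult_ac)
  finally show ?thesis by (simp add: v_def)
qed

lemma Taylor_cubic_lower_bound:
  fixes Q Q1 Q2 Q3 :: "real \<Rightarrow> real"
  assumes d: "\<And>s. (Q has_real_derivative Q1 s) (at s)" "\<And>s. (Q1 has_real_derivative Q2 s) (at s)"
    "\<And>s. (Q2 has_real_derivative Q3 s) (at s)"
    and K: "\<And>s. \<bar>s\<bar> \<le> L \<Longrightarrow> \<bar>Q3 s\<bar> \<le> K" and L: "\<bar>s\<bar> \<le> L" "\<bar>s + \<tau>\<bar> \<le> L"
  shows "Q s + Q1 s * \<tau> + Q2 s / 2 * \<tau>\<^sup>2 - K * \<bar>\<tau>\<bar> ^ 3 \<le> Q (s + \<tau>)"
proof (cases "\<tau> = 0")
  case False
  define diff where "diff k = (if k = 0 then Q else if k = 1 then Q1 else if k = 2 then Q2 else Q3)" for k :: nat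
  have "\<exists>t. (if s + \<tau> < s then s + \<tau> < t \<and> t < s else s < t \<and> t < s + \<tau>) \<and>
    Q (s + \<tau>) = (\<Sum>k<3. (diff k s / fact k) * (s + \<tau> - s) ^ k) + (diff 3 t / fact 3) * (s + \<tau> - s) ^ 3"
  proof (rule Taylor)
    show "\<forall>k t. k < 3 \<and> - L \<le> t \<and> t \<le> L \<longrightarrow> DERIV (diff k) t :> diff (Suc k) t"
    proof (intro allI impI)
      fix k :: nat and t assume "k < 3 \<and> - L \<le> t \<and> t \<le> L"
      then have "k = 0 \<or> k = 1 \<or> k = 2" by auto
      then show "DERIV (diff k) t :> diff (Suc k) t" using d by (auto simp: diff_def)
    qed
  qed (use L False in \<open>auto simp: diff_def\<close>)
  then obtain t where t: "if s + \<tau> < s then s + \<tau> < t \<and> t < s else s < t \<and> t < s + \<tau>"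
    and eq: "Q (s + \<tau>) = (\<Sum>k<3. (diff k s / fact k) * (s + \<tau> - s) ^ k) + (diff 3 t / fact 3) * (s + \<tau> - s) ^ 3"
    by blast
  have "\<bar>t\<bar> \<le> L" using t L by (auto split: if_splits)
  then have q3: "\<bar>Q3 t\<bar> \<le> K" by (rule K)
  have "\<bar>Q3 t / 6 * \<tau> ^ 3\<bar> = \<bar>Q3 t\<bar> / 6 * \<bar>\<tau>\<bar> ^ 3" by (simp add: abs_mult power_abs)
  also have "\<dots> \<le> K * \<bar>\<tau>\<bar> ^ 3" using q3 by (intro mult_right_mono) auto
  finally have "- (K * \<bar>\<tau>\<bar> ^ 3) \<le> Q3 t / 6 * \<tau> ^ 3" by linarith
  moreover have "Q (s + \<tau>) = Q s + Q1 s * \<tau> + Q2 s / 2 * \<tau>\<^sup>2 + Q3 t / 6 * \<tau> ^ 3"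
    unfolding eq by (simp add: diff_def eval_nat_numeral lessThan_Suc fact_Suc)
  ultimately show ?thesis by linarith
qed simp

lemma norm_add_axis_squared:
  fixes y :: "real ^ 'n"
  shows "(norm (y + axis j a))\<^sup>2 = (norm y)\<^sup>2 + (2 * a * y $ j + a\<^sup>2)"
    "(norm (y - axis j a))\<^sup>2 = (norm y)\<^sup>2 + (- (2 * a * y $ j) + a\<^sup>2)"
proof -
  have "(axis j a :: real ^ 'n) \<bullet> axis j a = a\<^sup>2" by (simp add: inner_axis_axis power2_eq_square)
  then show "(norm (y + axis j a))\<^sup>2 = (norm y)\<^sup>2 + (2 * a * y $ j + a\<^sup>2)"
    "(norm (y - axis j a))\<^sup>2 = (norm y)\<^sup>2 + (- (2 * a * y $ j) + a\<^sup>2)"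
    by (simp_all add: power2_norm_eq_inner inner_add_left inner_add_right inner_diff_left inner_diff_right
        inner_axis inner_axis' algebra_simps inner_commute)
qed

lemma bounded_on_symmetric_Icc:
  fixes f :: "real \<Rightarrow> real"
  assumes "continuous_on UNIV f"
  obtains K where "K \<ge> 0" "\<And>s. \<bar>s\<bar> \<le> L \<Longrightarrow> \<bar>f s\<bar> \<le> K"
proof -
  have "compact (f ` {- L..L})"
    by (intro compact_continuous_image continuous_on_subset[OF assms]) auto
  then obtain K where "\<forall>x\<in>f ` {- L..L}. norm x \<le> K"
    using compact_imp_bounded bounded_iff by metis
  then have "\<bar>f s\<bar> \<le> max K 0" if "\<bar>s\<bar> \<le> L" for s
    using that by (auto simp: abs_le_iff[of s] minus_le_iff le_max_iff_disj)
  then show ?thesis using that[of "max K 0"] by simp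
qed

text \<open>For \<open>h y = Q (|y|\<^sup>2)\<close> the Laplacian is \<open>2 d Q' + 4 |y|\<^sup>2 Q''\<close>, and the second difference agrees with it up
  to \<open>O(1/N)\<close>. Only an inequality is claimed, so \<open>h\<close> may exceed the smooth function \<open>Q\<close> away from
  \<open>y\<close>: neighbours enter the second difference with a positive sign. This is how the kink of the profile at
  the sphere is handled.\<close>

lemma disc_lap_ge:
  fixes Q Q1 Q2 Q3 :: "real \<Rightarrow> real"
  assumes d: "\<And>s. (Q has_real_derivative Q1 s) (at s)" "\<And>s. (Q1 has_real_derivative Q2 s) (at s)"
    "\<And>s. (Q2 has_real_derivative Q3 s) (at s)" and Q3: "continuous_on UNIV Q3" and R: "0 \<le> R"
  obtains C where "\<And>(h :: real ^ 'n \<Rightarrow> real) N y. 1 \<le> N \<Longrightarrow> norm y \<le> R \<Longrightarrow> h y = Q ((norm y)\<^sup>2) \<Longrightarrow>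
    (\<And>z. norm z \<le> R + 1 / N \<Longrightarrow> Q ((norm z)\<^sup>2) \<le> h z) \<Longrightarrow>
    2 * real CARD('n) * Q1 ((norm y)\<^sup>2) + 4 * (norm y)\<^sup>2 * Q2 ((norm y)\<^sup>2) - C / N \<le> disc_lap N h y"
proof -
  define L where "L = (R + 1)\<^sup>2"
  obtain K where K: "K \<ge> 0" "\<And>s. \<bar>s\<bar> \<le> L \<Longrightarrow> \<bar>Q3 s\<bar> \<le> K"
    using bounded_on_symmetric_Icc[OF Q3] by metis
  have "continuous_on UNIV Q2" using DERIV_continuous_on d(3) by (metis has_field_derivative_at_within)
  then obtain K2 where K2: "K2 \<ge> 0" "\<And>s. \<bar>s\<bar> \<le> L \<Longrightarrow> \<bar>Q2 s\<bar> \<le> K2"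
    using bounded_on_symmetric_Icc by metis
  define E where "E = K2 + 2 * K * (2 * R + 1) ^ 3"
  define C where "C = real CARD('n) * E"
  show ?thesis
  proof (rule that[of C])
    fix h :: "real ^ 'n \<Rightarrow> real" and N :: real and y
    assume N: "1 \<le> N" and y: "norm y \<le> R" and hy: "h y = Q ((norm y)\<^sup>2)"
      and hz: "\<And>z. norm z \<le> R + 1 / N \<Longrightarrow> Q ((norm z)\<^sup>2) \<le> h z"
    define s where "s = (norm y)\<^sup>2"
    define b where "b = 1 / N"
    have b: "0 < b" "b \<le> 1" "N * b = 1" using N by (simp_all add: b_def)
    have step: "2 * Q1 s * b\<^sup>2 + 4 * (y $ j)\<^sup>2 * Q2 s * b\<^sup>2 - E * b ^ 3
        \<le> h (y + axis j b) + h (y - axis j b) - 2 * h y" for j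
    proof -
      \<comment> \<open>\<open>|y \<plusminus> b e\<^sub>j|\<^sup>2 = s \<plusminus> a + b\<^sup>2\<close>; the odd powers of \<open>a\<close> cancel between the two neighbours.\<close>
      define a where "a = 2 * b * y $ j"
      have yj: "\<bar>y $ j\<bar> \<le> R" using component_le_norm_cart[of y j] y by simp
      have ax: "norm (axis j b :: real ^ 'n) = b"
      proof -
        have "axis j b = b *\<^sub>R (axis j 1 :: real ^ 'n)" by (simp add: vec_eq_iff axis_def)
        then show ?thesis using b by (simp add: norm_axis_1)
      qed
      have np: "norm (y + axis j b) \<le> R + 1 / N" "norm (y - axis j b) \<le> R + 1 / N"
        using norm_triangle_ineq[of y "axis j b"] norm_triangle_ineq4[of y "axis j b"] ax y
        by (simp_all add: b_def)
      have Lb: "\<bar>(norm z)\<^sup>2\<bar> \<le> L" if "norm z \<le> R + 1 / N" for z :: "real ^ 'n"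
        unfolding L_def abs_power2 using that b(2) by (intro power_mono) (simp_all add: b_def)
      have sL: "\<bar>s\<bar> \<le> L" unfolding s_def using y N R by (intro Lb) (auto intro: order_trans)
      have small: "\<bar>\<tau>\<bar> ^ 3 \<le> (2 * R + 1) ^ 3 * b ^ 3" if "\<bar>\<tau>\<bar> \<le> \<bar>a\<bar> + b\<^sup>2" for \<tau>
      proof -
        have "\<bar>a\<bar> \<le> 2 * b * R" unfolding a_def using yj b by (simp add: abs_mult)
        moreover have "b\<^sup>2 \<le> b" using b by (simp add: power2_eq_square mult_left_le)
        ultimately have "\<bar>\<tau>\<bar> \<le> (2 * R + 1) * b" using that by (simp add: algebra_simps)
        then have "\<bar>\<tau>\<bar> ^ 3 \<le> ((2 * R + 1) * b) ^ 3" by (intro power_mono) auto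
        then show ?thesis by (simp add: power_mult_distrib)
      qed
      have T1: "Q s + Q1 s * (a + b\<^sup>2) + Q2 s / 2 * (a + b\<^sup>2)\<^sup>2 - K * \<bar>a + b\<^sup>2\<bar> ^ 3 \<le> h (y + axis j b)"
      proof -
        have "Q s + Q1 s * (a + b\<^sup>2) + Q2 s / 2 * (a + b\<^sup>2)\<^sup>2 - K * \<bar>a + b\<^sup>2\<bar> ^ 3 \<le> Q (s + (a + b\<^sup>2))"
          by (rule Taylor_cubic_lower_bound[OF d K(2) sL])
            (use Lb[OF np(1)] in \<open>simp_all add: norm_add_axis_squared a_def s_def\<close>)
        also have "\<dots> \<le> h (y + axis j b)"
          using hz[OF np(1)] by (simp add: norm_add_axis_squared a_def s_def)
        finally show ?thesis .
      qed
      have T2: "Q s + Q1 s * (- a + b\<^sup>2) + Q2 s / 2 * (- a + b\<^sup>2)\<^sup>2 - K * \<bar>- a + b\<^sup>2\<bar> ^ 3 \<le> h (y - axis j b)"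
      proof -
        have "Q s + Q1 s * (- a + b\<^sup>2) + Q2 s / 2 * (- a + b\<^sup>2)\<^sup>2 - K * \<bar>- a + b\<^sup>2\<bar> ^ 3 \<le> Q (s + (- a + b\<^sup>2))"
          by (rule Taylor_cubic_lower_bound[OF d K(2) sL])
            (use Lb[OF np(2)] in \<open>simp_all add: norm_add_axis_squared a_def s_def\<close>)
        also have "\<dots> \<le> h (y - axis j b)"
          using hz[OF np(2)] by (simp add: norm_add_axis_squared a_def s_def)
        finally show ?thesis .
      qed
      have "\<bar>a + b\<^sup>2\<bar> \<le> \<bar>a\<bar> + b\<^sup>2" "\<bar>- a + b\<^sup>2\<bar> \<le> \<bar>a\<bar> + b\<^sup>2"
        using zero_le_power2[of b] by linarith+
      then have "K * \<bar>a + b\<^sup>2\<bar> ^ 3 \<le> K * ((2 * R + 1) ^ 3 * b ^ 3)" "K * \<bar>- a + b\<^sup>2\<bar> ^ 3 \<le> K * ((2 * R + 1) ^ 3 * b ^ 3)"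
        by (simp_all add: mult_left_mono small K(1))
      moreover have "- (K2 * b ^ 3) \<le> Q2 s * b ^ 4"
      proof -
        have "\<bar>Q2 s * b ^ 4\<bar> \<le> K2 * b ^ 3"
          unfolding abs_mult using K2 sL b by (intro mult_mono) (auto intro!: power_decreasing)
        then show ?thesis by linarith
      qed
      moreover have "Q s + Q1 s * (a + b\<^sup>2) + Q2 s / 2 * (a + b\<^sup>2)\<^sup>2 + (Q s + Q1 s * (- a + b\<^sup>2) + Q2 s / 2 * (- a + b\<^sup>2)\<^sup>2)
          = 2 * h y + 2 * Q1 s * b\<^sup>2 + 4 * (y $ j)\<^sup>2 * Q2 s * b\<^sup>2 + Q2 s * b ^ 4"
        unfolding hy s_def[symmetric] a_def by (simp add: power2_eq_square eval_nat_numeral field_simps)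
      ultimately show ?thesis using T1 T2 by (simp add: E_def algebra_simps)
    qed
    have "(2 * real CARD('n) * Q1 s + 4 * s * Q2 s - C / N) * b\<^sup>2 =
        (\<Sum>j\<in>UNIV. 2 * Q1 s * b\<^sup>2 + 4 * (y $ j)\<^sup>2 * Q2 s * b\<^sup>2 - E * b ^ 3)"
    proof -
      have C_N: "C / N = real CARD('n) * E * b" by (simp add: C_def b_def)
      have "(\<Sum>j\<in>UNIV. (y $ j)\<^sup>2) = s" by (simp add: s_def norm_vec_def L2_set_def sum_nonneg)
      then have "(\<Sum>j\<in>UNIV. 4 * (y $ j)\<^sup>2 * Q2 s * b\<^sup>2) = 4 * s * Q2 s * b\<^sup>2"
        by (simp add: sum_distrib_left[symmetric] sum_distrib_right[symmetric])
      then show ?thesis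
        by (simp add: sum.distrib sum_subtractf C_N power2_eq_square power3_eq_cube algebra_simps)
    qed
    also have "\<dots> \<le> (\<Sum>j\<in>UNIV. h (y + axis j b) + h (y - axis j b) - 2 * h y)"
      by (intro sum_mono step)
    finally have "N\<^sup>2 * ((2 * real CARD('n) * Q1 s + 4 * s * Q2 s - C / N) * b\<^sup>2) \<le> disc_lap N h y"
      unfolding disc_lap_def b_def by (intro mult_left_mono) auto
    moreover have "N\<^sup>2 * (x * b\<^sup>2) = x" for x
      using b(3) by (metis mult.left_commute mult_1_right power_mult_distrib power_one)
    ultimately show "2 * real CARD('n) * Q1 ((norm y)\<^sup>2) + 4 * (norm y)\<^sup>2 * Q2 ((norm y)\<^sup>2) - C / N \<le> disc_lap N h y"
      by (simp only: s_def)
  qed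
qed

text \<open>The solution of \<open>h + \<Delta>h / (4 c) = 1\<close> in the ball of radius \<open>R\<close> of dimension
  \<open>2 \<nu> + 2\<close> with zero boundary values, extended by \<open>0\<close>.\<close>

definition ball_profile :: "real \<Rightarrow> real \<Rightarrow> real \<Rightarrow> real ^ 'n \<Rightarrow> real" where
  "ball_profile \<nu> c R y =
     (if norm y \<le> R then 1 + clifford \<nu> (c * (norm y)\<^sup>2) / (- clifford \<nu> (c * R\<^sup>2)) else 0)"

lemma ball_profile_nonneg:
  assumes "\<nu> \<ge> 0" "c \<ge> 0" "clifford \<nu> (c * R\<^sup>2) < 0"
    "\<And>r. 0 \<le> r \<Longrightarrow> r < T \<Longrightarrow> clifford (\<nu> + 1) r > 0" "c * R\<^sup>2 \<le> T"
  shows "0 \<le> ball_profile \<nu> c R y"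
proof (cases "norm y \<le> R")
  case True
  then have "c * (norm y)\<^sup>2 \<le> c * R\<^sup>2" using assms by (intro mult_left_mono power_mono) auto
  then have "clifford \<nu> (c * R\<^sup>2) \<le> clifford \<nu> (c * (norm y)\<^sup>2)"
    by (intro clifford_decreasing[OF assms(1,4)]) (use assms in auto)
  then show ?thesis using assms(3) True by (simp add: ball_profile_def field_simps)
qed (simp add: ball_profile_def)

text \<open>The profile vanishes on the sphere, so clipping \<open>|y|\<^sup>2\<close> at \<open>R\<^sup>2\<close> gives a formula valid everywhere.\<close>

lemma continuous_on_ball_profile:
  assumes "\<nu> \<ge> 0" "R \<ge> 0" "clifford \<nu> (c * R\<^sup>2) < 0"
  shows "continuous_on UNIV (ball_profile \<nu> c R :: real ^ 'n \<Rightarrow> real)"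
proof -
  have "ball_profile \<nu> c R = (\<lambda>y :: real ^ 'n. 1 + clifford \<nu> (c * min ((norm y)\<^sup>2) (R\<^sup>2)) / (- clifford \<nu> (c * R\<^sup>2)))"
  proof
    fix y :: "real ^ 'n"
    show "ball_profile \<nu> c R y = 1 + clifford \<nu> (c * min ((norm y)\<^sup>2) (R\<^sup>2)) / (- clifford \<nu> (c * R\<^sup>2))"
    proof (cases "norm y \<le> R")
      case True
      then have "(norm y)\<^sup>2 \<le> R\<^sup>2" by (intro power_mono) auto
      then show ?thesis using True by (simp add: ball_profile_def min_absorb1)
    next
      case False
      then have "R\<^sup>2 \<le> (norm y)\<^sup>2" using assms by (intro power_mono) auto
      then show ?thesis using False assms by (simp add: ball_profile_def min_absorb2)
    qed
  qed
  then show ?thesis using assms by (auto intro!: continuous_intros)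
qed

text \<open>Inside the ball the smooth continuation of the profile satisfies the equation \<open>Q + \<kappa> (2 d Q' + 4 s Q'') = 1\<close>,
  which is the three-term recurrence. Just outside the ball this continuation is negative, as the Bessel
  function keeps decreasing up to \<open>T\<close>; hence the profile dominates it, and \<open>disc_lap_ge\<close> applies.\<close>

lemma ball_profile_laplacian:
  fixes m R T :: real
  defines "\<nu> \<equiv> real CARD('n) / 2 - 1" and "c \<equiv> pi\<^sup>2 * m\<^sup>2"
  assumes d: "CARD('n) \<ge> 2" and m: "m > 0" and R: "R > 0" and neg: "clifford \<nu> (c * R\<^sup>2) < 0"
    and pos: "\<And>r. 0 \<le> r \<Longrightarrow> r < T \<Longrightarrow> clifford (\<nu> + 1) r > 0" and T: "c * R\<^sup>2 < T" and \<epsilon>: "\<epsilon> > 0"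
  shows "\<forall>\<^sub>F N in sequentially. \<forall>y :: real ^ 'n. norm y \<le> R \<longrightarrow>
      1 - \<epsilon> \<le> ball_profile \<nu> c R y + 1 / (4 * pi\<^sup>2 * m\<^sup>2) * disc_lap (real N) (ball_profile \<nu> c R) y"
proof -
  have \<nu>: "\<nu> \<ge> 0" using d by (simp add: \<nu>_def)
  have c: "c > 0" using m by (simp add: c_def)
  define B where "B = - clifford \<nu> (c * R\<^sup>2)"
  have B: "B > 0" using neg by (simp add: B_def)
  define Q where "Q s = 1 + 1 / B * clifford \<nu> (c * s)" for s
  define Q1 where "Q1 s = (- c * (1 / B)) * clifford (\<nu> + 1) (c * s)" for s
  define Q2 where "Q2 s = (- c * (- c * (1 / B))) * clifford (\<nu> + 1 + 1) (c * s)" for s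
  define Q3 where "Q3 s = (- c * (- c * (- c * (1 / B)))) * clifford (\<nu> + 1 + 1 + 1) (c * s)" for s
  have dQ: "(Q has_real_derivative Q1 s) (at s)" for s
    unfolding Q_def Q1_def
    using DERIV_add[OF DERIV_const[of 1] has_real_derivative_clifford_scaled[OF \<nu>, of "1 / B" c s]]
    by (simp only: add_0_left)
  have dQ1: "(Q1 has_real_derivative Q2 s) (at s)" for s
    unfolding Q1_def Q2_def by (rule has_real_derivative_clifford_scaled) (use \<nu> in simp)
  have dQ2: "(Q2 has_real_derivative Q3 s) (at s)" for s
    unfolding Q2_def Q3_def by (rule has_real_derivative_clifford_scaled) (use \<nu> in simp)
  have contQ3: "continuous_on UNIV Q3"
    unfolding Q3_def using \<nu> by (intro continuous_intros) auto
  obtain C where C: "\<And>(h :: real ^ 'n \<Rightarrow> real) N y. 1 \<le> N \<Longrightarrow> norm y \<le> R \<Longrightarrow> h y = Q ((norm y)\<^sup>2) \<Longrightarrow>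
    (\<And>z. norm z \<le> R + 1 / N \<Longrightarrow> Q ((norm z)\<^sup>2) \<le> h z) \<Longrightarrow>
    2 * real CARD('n) * Q1 ((norm y)\<^sup>2) + 4 * (norm y)\<^sup>2 * Q2 ((norm y)\<^sup>2) - C / N \<le> disc_lap N h y"
    using disc_lap_ge[OF dQ dQ1 dQ2 contQ3 less_imp_le[OF R], where 'n = 'n] by metis
  have "(\<lambda>N. c * (R + 1 / real N)\<^sup>2) \<longlonglongrightarrow> c * (R + 0)\<^sup>2"
    by (intro tendsto_intros lim_const_over_n)
  then have "\<forall>\<^sub>F N in sequentially. c * (R + 1 / real N)\<^sup>2 < T"
    using T by (intro order_tendstoD) auto
  moreover have "(\<lambda>N. 1 / (4 * pi\<^sup>2 * m\<^sup>2) * (C / real N)) \<longlonglongrightarrow> 1 / (4 * pi\<^sup>2 * m\<^sup>2) * 0"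
    by (intro tendsto_intros lim_const_over_n)
  then have "\<forall>\<^sub>F N in sequentially. 1 / (4 * pi\<^sup>2 * m\<^sup>2) * (C / real N) < \<epsilon>"
    using \<epsilon> by (intro order_tendstoD) auto
  ultimately show ?thesis using eventually_ge_at_top[of 1]
  proof eventually_elim
    case (elim N)
    show ?case
    proof (intro allI impI)
      fix y :: "real ^ 'n" assume y: "norm y \<le> R"
      let ?h = "ball_profile \<nu> c R :: real ^ 'n \<Rightarrow> real"
      define s where "s = (norm y)\<^sup>2"
      have hy: "?h y = Q ((norm y)\<^sup>2)" using y by (simp add: ball_profile_def Q_def B_def)
      have hz: "Q ((norm z)\<^sup>2) \<le> ?h z" if z: "norm z \<le> R + 1 / real N" for z :: "real ^ 'n"
      proof (cases "norm z \<le> R")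
        case True
        then show ?thesis by (simp add: ball_profile_def Q_def B_def)
      next
        case False
        have "c * R\<^sup>2 \<le> c * (norm z)\<^sup>2" using False R c by (intro mult_left_mono power_mono) auto
        moreover have "c * (norm z)\<^sup>2 \<le> c * (R + 1 / real N)\<^sup>2" using z c by (intro mult_left_mono power_mono) auto
        then have "c * (norm z)\<^sup>2 \<le> T" using elim(1) by simp
        ultimately have "clifford \<nu> (c * (norm z)\<^sup>2) \<le> clifford \<nu> (c * R\<^sup>2)"
          using c by (intro clifford_decreasing[OF \<nu> pos]) auto
        then show ?thesis using False B by (simp add: ball_profile_def Q_def B_def field_simps)
      qed
      have lap: "2 * real CARD('n) * Q1 s + 4 * s * Q2 s - C / real N \<le> disc_lap (real N) ?h y"
        unfolding s_def by (rule C[OF _ y hy hz]) (use elim(3) in auto)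
      have "Q s + 1 / (4 * pi\<^sup>2 * m\<^sup>2) * (2 * real CARD('n) * Q1 s + 4 * s * Q2 s) =
          1 + 1 / B * (clifford \<nu> (c * s) - ((\<nu> + 1) * clifford (\<nu> + 1) (c * s) - (c * s) * clifford (\<nu> + 2) (c * s)))"
        using m B by (simp add: Q_def Q1_def Q2_def \<nu>_def c_def field_simps power2_eq_square)
      then have ode: "Q s + 1 / (4 * pi\<^sup>2 * m\<^sup>2) * (2 * real CARD('n) * Q1 s + 4 * s * Q2 s) = 1"
        using clifford_rec[OF \<nu>, of "c * s"] by simp
      have "1 / (4 * pi\<^sup>2 * m\<^sup>2) * (2 * real CARD('n) * Q1 s + 4 * s * Q2 s - C / real N)
          \<le> 1 / (4 * pi\<^sup>2 * m\<^sup>2) * disc_lap (real N) ?h y"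
        by (rule mult_left_mono[OF lap]) simp
      then show "1 - \<epsilon> \<le> ?h y + 1 / (4 * pi\<^sup>2 * m\<^sup>2) * disc_lap (real N) ?h y"
        using ode elim(2) hy unfolding s_def[symmetric] right_diff_distrib by linarith
    qed
  qed
qed

text \<open>In polar coordinates the integrand has the primitive \<open>G\<close>, because
  \<open>(r\<^sup>d f\<^sub>\<nu>\<^sub>+\<^sub>1(c r\<^sup>2))' = 2 r\<^sup>d\<^sup>-\<^sup>1 f\<^sub>\<nu>(c r\<^sup>2)\<close> for \<open>d = 2 \<nu> + 2\<close>, again by the recurrence.\<close>

lemma integral_ball_profile:
  fixes c R :: real
  defines "\<nu> \<equiv> real CARD('n) / 2 - 1"
  assumes d: "CARD('n) \<ge> 2" and R: "R > 0" and neg: "clifford \<nu> (c * R\<^sup>2) < 0"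
  shows "(\<integral>y. ball_profile \<nu> c R (y :: real ^ 'n) \<partial>lborel) =
    unit_ball_vol (real CARD('n)) * R ^ CARD('n) *
      (1 + real CARD('n) / 2 * clifford (\<nu> + 1) (c * R\<^sup>2) / (- clifford \<nu> (c * R\<^sup>2)))"
proof -
  let ?d = "CARD('n)"
  have \<nu>: "\<nu> \<ge> 0" using d by (simp add: \<nu>_def)
  define B where "B = - clifford \<nu> (c * R\<^sup>2)"
  define v where "v = unit_ball_vol (real CARD('n))"
  define g where "g r = 1 + clifford \<nu> (c * r\<^sup>2) / B" for r
  define G where "G r = v * r ^ ?d * (1 + real ?d / 2 * clifford (\<nu> + 1) (c * r\<^sup>2) / B)" for r
  have cg: "continuous_on A g" for A
    unfolding g_def divide_inverse by (intro continuous_intros \<nu>)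
  have "(\<integral>y. ball_profile \<nu> c R (y :: real ^ 'n) \<partial>lborel) =
      (\<integral>y. indicator (cball (0 :: real ^ 'n) R) y * g (norm y) \<partial>lborel)"
    by (intro Bochner_Integration.integral_cong) (auto simp: ball_profile_def g_def B_def indicator_def)
  also have "\<dots> = (\<integral>r. real ?d * v * r ^ (?d - 1) * g r * indicator {0..R} r \<partial>lborel)"
    using integral_cball_radial[of R g, where 'a = "real ^ 'n"] R cg[of UNIV]
    by (simp add: v_def borel_measurable_continuous_onI)
  also have "\<dots> = G R - G 0"
  proof (rule integral_FTC_Icc_real)
    fix r :: real
    show "isCont (\<lambda>r. real ?d * v * r ^ (?d - 1) * g r) r"
      using cg[of UNIV] by (intro continuous_intros) (simp add: continuous_on_eq_continuous_at)
    have p: "r ^ ?d = r ^ (?d - 1) * r" using d by (metis One_nat_def Suc_pred le_numeral_extra(4) mult.commute power_Suc zero_less_card_finite)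
    have d2: "((\<lambda>r. 1 + real ?d / 2 * clifford (\<nu> + 1) (c * r\<^sup>2) / B) has_real_derivative
        (real ?d / 2 * (- clifford (\<nu> + 1 + 1) (c * r\<^sup>2) * (c * (2 * r))) / B)) (at r)"
    proof -
      have "((\<lambda>r. c * r\<^sup>2) has_real_derivative c * (2 * r)) (at r)"
        by (auto intro!: derivative_eq_intros)
      then have "((\<lambda>r. clifford (\<nu> + 1) (c * r\<^sup>2)) has_real_derivative
          - clifford (\<nu> + 1 + 1) (c * r\<^sup>2) * (c * (2 * r))) (at r)"
        by (intro DERIV_chain2[OF has_real_derivative_clifford]) (use \<nu> in auto)
      from DERIV_add[OF DERIV_const[of 1] DERIV_cdivide[OF DERIV_cmult[OF this, of "real ?d / 2"], of B]]
      show ?thesis by (simp only: add_0_left)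
    qed
    have d1: "((\<lambda>r. v * r ^ ?d) has_real_derivative v * (real ?d * r ^ (?d - 1))) (at r)"
      by (auto intro!: derivative_eq_intros)
    have "(G has_real_derivative v * (real ?d * r ^ (?d - 1)) * (1 + real ?d / 2 * clifford (\<nu> + 1) (c * r\<^sup>2) / B)
        + (real ?d / 2 * (- clifford (\<nu> + 1 + 1) (c * r\<^sup>2) * (c * (2 * r))) / B) * (v * r ^ ?d)) (at r)"
      unfolding G_def by (rule DERIV_mult[OF d1 d2])
    also have "v * (real ?d * r ^ (?d - 1)) * (1 + real ?d / 2 * clifford (\<nu> + 1) (c * r\<^sup>2) / B)
        + (real ?d / 2 * (- clifford (\<nu> + 1 + 1) (c * r\<^sup>2) * (c * (2 * r))) / B) * (v * r ^ ?d) =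
        real ?d * v * r ^ (?d - 1) * (1 + ((\<nu> + 1) * clifford (\<nu> + 1) (c * r\<^sup>2) - (c * r\<^sup>2) * clifford (\<nu> + 2) (c * r\<^sup>2)) / B)"
      unfolding p by (simp add: \<nu>_def power2_eq_square add_divide_distrib diff_divide_distrib algebra_simps)
    also have "\<dots> = real ?d * v * r ^ (?d - 1) * g r"
      unfolding g_def by (simp only: clifford_rec[OF \<nu>, symmetric])
    finally show "(G has_real_derivative real ?d * v * r ^ (?d - 1) * g r) (at r)" .
  qed (use R in simp)
  also have "\<dots> = v * R ^ ?d * (1 + real ?d / 2 * clifford (\<nu> + 1) (c * R\<^sup>2) / B)"
    using d by (simp add: G_def power_0_left)
  finally show ?thesis by (simp add: v_def B_def)
qed

section \<open>The constant and the frame bound on the lattice\<close>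

text \<open>The integral of \<open>ball_profile\<close> in dimension \<open>d\<close>, as a function of its radius.\<close>

definition profile_mass :: "nat \<Rightarrow> real \<Rightarrow> real \<Rightarrow> real" where
  "profile_mass d m R = unit_ball_vol (real d) * R ^ d *
     (1 + real d / 2 * clifford (real d / 2) (pi\<^sup>2 * m\<^sup>2 * R\<^sup>2) / (- clifford (real d / 2 - 1) (pi\<^sup>2 * m\<^sup>2 * R\<^sup>2)))"

text \<open>Lemma \<open>sum_squares_le_of_profile\<close> for \<open>ball_profile\<close>. The radius stays strictly below the first zero of
  \<open>f\<^sub>\<nu>\<^sub>+\<^sub>1\<close>, so that the smooth continuation of the profile is still decreasing just outside the ball.\<close>

lemma lattice_sum_ge_strict:
  fixes p :: "'i \<Rightarrow> real ^ 'n" and u :: "'i \<Rightarrow> complex" and m R T \<delta> :: real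
  defines "\<nu> \<equiv> real CARD('n) / 2 - 1" and "c \<equiv> pi\<^sup>2 * m\<^sup>2"
  assumes d: "CARD('n) \<ge> 2" and m: "m > 0" and R: "R > 0" and neg: "clifford \<nu> (c * R\<^sup>2) < 0"
    and pos: "\<And>r. 0 \<le> r \<Longrightarrow> r < T \<Longrightarrow> clifford (\<nu> + 1) r > 0" and T: "c * R\<^sup>2 < T"
    and I: "finite I" and \<delta>: "\<delta> > 0"
    and sep: "\<And>i j k. i \<in> I \<Longrightarrow> j \<in> I \<Longrightarrow> i \<noteq> j \<Longrightarrow> k \<in> int_lattice \<Longrightarrow> norm (p i - p j + k) \<ge> 2 * R + \<delta>"
  shows "(\<Sum>i\<in>I. (cmod (u i))\<^sup>2) \<le> profile_mass CARD('n) m R *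
    (\<Sum>n\<in>int_lattice \<inter> cball 0 m. (cmod (\<Sum>i\<in>I. u i * char_exp n (p i)))\<^sup>2)"
proof -
  let ?h = "ball_profile \<nu> c R :: real ^ 'n \<Rightarrow> real"
  have \<nu>: "\<nu> \<ge> 0" using d by (simp add: \<nu>_def)
  have c: "c \<ge> 0" by (simp add: c_def)
  have nonneg: "0 \<le> ?h y" for y
    by (rule ball_profile_nonneg[OF \<nu> c neg pos]) (use T in auto)
  have supp: "norm y \<le> R" if "?h y \<noteq> 0" for y
    using that by (simp add: ball_profile_def split: if_splits)
  have cont: "continuous_on UNIV ?h"
    by (rule continuous_on_ball_profile[OF \<nu> less_imp_le[OF R] neg])
  have "bounded (?h ` cball 0 R)"
    by (intro compact_imp_bounded compact_continuous_image continuous_on_subset[OF cont]) auto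
  then obtain C where C: "\<And>y. y \<in> cball 0 R \<Longrightarrow> norm (?h y) \<le> C"
    unfolding bounded_iff by blast
  have bound: "\<bar>?h y\<bar> \<le> max C 0" for y
    using C[of y] supp[of y] by (cases "?h y = 0") (auto simp: le_max_iff_disj)
  have mass: "(\<integral>y. ?h y \<partial>lborel) = profile_mass CARD('n) m R"
    using integral_ball_profile[where 'n = 'n, OF d R, of c] neg
    by (simp add: profile_mass_def \<nu>_def c_def)
  have "profile_mass CARD('n) m R > 0"
  proof -
    have "clifford (real CARD('n) / 2) (pi\<^sup>2 * m\<^sup>2 * R\<^sup>2) > 0"
      using pos[of "c * R\<^sup>2"] T c by (simp add: \<nu>_def c_def)
    then show ?thesis
      unfolding profile_mass_def using R neg
      by (intro mult_pos_pos add_pos_nonneg divide_nonneg_pos) (auto simp: \<nu>_def c_def)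
  qed
  moreover have "(\<lambda>N. (1 / real N) ^ CARD('n) * (\<Sum>k\<in>int_lattice \<inter> cball 0 (real N * (R + 1)). ?h ((1 / real N) *\<^sub>R k)))
      \<longlonglongrightarrow> profile_mass CARD('n) m R"
    unfolding mass[symmetric]
  proof (rule riemann_sum_tendsto[where C = "max C 0"])
    show "?h \<in> borel_measurable lborel" using borel_measurable_continuous_onI[OF cont] by simp
    show "norm y \<le> R + 1" if "?h y \<noteq> 0" for y using supp[OF that] by simp
    show "AE x in lborel. isCont ?h x" using cont by (simp add: continuous_on_eq_continuous_at)
  qed (rule bound)
  ultimately show ?thesis
    using ball_profile_laplacian[where 'n = 'n, OF d m R neg[unfolded \<nu>_def c_def] pos[unfolded \<nu>_def] T[unfolded c_def]]
    by (intro sum_squares_le_of_profile[OF m I nonneg supp _ _ _ \<delta> sep]) (auto simp: \<nu>_def c_def)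
qed

text \<open>The hypotheses of \<open>lattice_sum_ge_strict\<close> hold for every slightly smaller radius, and the bound is
  continuous in the radius.\<close>

lemma lattice_sum_ge:
  fixes p :: "'i \<Rightarrow> real ^ 'n" and u :: "'i \<Rightarrow> complex" and m R S T :: real
  defines "\<nu> \<equiv> real CARD('n) / 2 - 1"
  assumes d: "CARD('n) \<ge> 2" and m: "m > 0" and R: "R > 0"
    and neg: "\<And>r. S < r \<Longrightarrow> r \<le> T \<Longrightarrow> clifford \<nu> r < 0"
    and pos: "\<And>r. 0 \<le> r \<Longrightarrow> r < T \<Longrightarrow> clifford (\<nu> + 1) r > 0"
    and ST: "S < pi\<^sup>2 * m\<^sup>2 * R\<^sup>2" "pi\<^sup>2 * m\<^sup>2 * R\<^sup>2 \<le> T"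
    and I: "finite I"
    and sep: "\<And>i j k. i \<in> I \<Longrightarrow> j \<in> I \<Longrightarrow> i \<noteq> j \<Longrightarrow> k \<in> int_lattice \<Longrightarrow> norm (p i - p j + k) \<ge> 2 * R"
  shows "(\<Sum>i\<in>I. (cmod (u i))\<^sup>2) \<le> profile_mass CARD('n) m R *
    (\<Sum>n\<in>int_lattice \<inter> cball 0 m. (cmod (\<Sum>i\<in>I. u i * char_exp n (p i)))\<^sup>2)"
proof -
  let ?c = "pi\<^sup>2 * m\<^sup>2" and ?F = "\<Sum>n\<in>int_lattice \<inter> cball 0 m. (cmod (\<Sum>i\<in>I. u i * char_exp n (p i)))\<^sup>2"
  have \<nu>: "\<nu> \<ge> 0" using d by (simp add: \<nu>_def)
  have cl: "isCont (clifford \<mu>) x" if "\<mu> \<ge> 0" for \<mu> x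
    using has_real_derivative_clifford[OF that] by (rule DERIV_isCont)
  have neg0: "clifford \<nu> (?c * R\<^sup>2) \<noteq> 0" using neg ST by force
  have "((\<lambda>R. clifford \<mu> (?c * R\<^sup>2)) \<longlongrightarrow> clifford \<mu> (?c * R\<^sup>2)) (at_left R)" if "\<mu> \<ge> 0" for \<mu>
    by (intro isCont_tendsto_compose[OF cl[OF that]] tendsto_intros)
  then have "((\<lambda>R. profile_mass CARD('n) m R) \<longlongrightarrow> profile_mass CARD('n) m R) (at_left R)"
    unfolding profile_mass_def using \<nu> neg0
    by (intro tendsto_intros) (auto simp: \<nu>_def)
  then have lim: "((\<lambda>R. profile_mass CARD('n) m R * ?F) \<longlongrightarrow> profile_mass CARD('n) m R * ?F) (at_left R)"
    by (intro tendsto_intros)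
  have "((\<lambda>R. ?c * R\<^sup>2) \<longlongrightarrow> ?c * R\<^sup>2) (at_left R)" by (intro tendsto_intros)
  then have "\<forall>\<^sub>F R' in at_left R. S < ?c * R'\<^sup>2" using ST(1) by (rule order_tendstoD)
  moreover have "\<forall>\<^sub>F R' in at_left R. R' \<in> {0<..<R}" using R by (rule eventually_at_left_real)
  ultimately have "\<forall>\<^sub>F R' in at_left R. (\<Sum>i\<in>I. (cmod (u i))\<^sup>2) \<le> profile_mass CARD('n) m R' * ?F"
  proof eventually_elim
    case (elim R')
    then have R': "0 < R'" "R' < R" by auto
    then have "?c * R'\<^sup>2 < ?c * R\<^sup>2" using m by (intro mult_strict_left_mono power_strict_mono) auto
    then have T: "?c * R'\<^sup>2 < T" using ST(2) by (rule less_le_trans)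
    show ?case
    proof (rule lattice_sum_ge_strict[OF d m R'(1) _ _ T I, of "2 * (R - R')"])
      show "clifford (real CARD('n) / 2 - 1) (?c * R'\<^sup>2) < 0" using neg[OF elim(1)] T by (simp add: \<nu>_def)
    qed (use pos R' sep in \<open>auto simp: \<nu>_def\<close>)
  qed
  then show ?thesis
    by (intro tendsto_lowerbound[OF lim]) auto
qed

lemma sphere_measure_unit:
  "sphere_measure (sphere (0 :: real ^ 'n) 1) = real CARD('n) * unit_ball_vol (real CARD('n))"
proof -
  have "{r *\<^sub>R x | r x. 0 < r \<and> r \<le> 1 \<and> x \<in> sphere (0 :: real ^ 'n) 1} = cball 0 1 - {0}"
  proof (intro equalityI subsetI)
    fix y :: "real ^ 'n" assume "y \<in> cball 0 1 - {0}"
    then have "y = norm y *\<^sub>R (y /\<^sub>R norm y) \<and> 0 < norm y \<and> norm y \<le> 1 \<and> y /\<^sub>R norm y \<in> sphere 0 1"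
      by simp
    then show "y \<in> {r *\<^sub>R x | r x. 0 < r \<and> r \<le> 1 \<and> x \<in> sphere 0 1}" by blast
  qed auto
  moreover have "measure lebesgue (cball (0 :: real ^ 'n) 1 - {0}) = measure lebesgue (cball (0 :: real ^ 'n) 1)"
    by (rule measure_Diff_null_set) auto
  ultimately show ?thesis
    unfolding sphere_measure_def by (simp add: measure_completion content_cball)
qed

text \<open>For \<open>\<alpha>\<close> below \<open>j / pi\<close>, where \<open>j\<close> is the first zero of \<open>J\<close> of order \<open>d / 2\<close>, the constant equals the
  reciprocal of the profile's mass at \<open>R = \<alpha> / (2 m)\<close>, since \<open>\<gamma>(\<alpha>) = - 2 f\<^sub>\<nu> / f\<^sub>\<nu>\<^sub>+\<^sub>1\<close> at \<open>(pi \<alpha> / 2)\<^sup>2\<close>. For larger \<open>\<alpha>\<close>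
  the profile for \<open>j / pi\<close> is used; its mass is the volume of the ball, and the claimed constant is
  smaller than its reciprocal by the factor \<open>d\<close>.\<close>

lemma lattice_sum_ge_c_const:
  fixes p :: "'i \<Rightarrow> real ^ 'n" and u :: "'i \<Rightarrow> complex" and m \<alpha> :: real
  assumes d: "CARD('n) \<ge> 2" and m: "m > 0" and \<alpha>: "\<alpha> > Bessel_zero (real CARD('n) / 2 - 1) 1 / pi"
    and I: "finite I"
    and sep: "\<And>i j k. i \<in> I \<Longrightarrow> j \<in> I \<Longrightarrow> i \<noteq> j \<Longrightarrow> k \<in> int_lattice \<Longrightarrow> norm (p i - p j + k) \<ge> \<alpha> / m"
  shows "c_const TYPE('n) \<alpha> * m ^ CARD('n) * (\<Sum>i\<in>I. (cmod (u i))\<^sup>2) \<le>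
    (\<Sum>n\<in>int_lattice \<inter> cball 0 m. (cmod (\<Sum>i\<in>I. u i * char_exp n (p i)))\<^sup>2)"
proof -
  define \<nu> where "\<nu> = real CARD('n) / 2 - 1"
  have \<nu>: "\<nu> \<ge> 0" using d by (simp add: \<nu>_def)
  have \<nu>1: "\<nu> + 1 = real CARD('n) / 2" by (simp add: \<nu>_def)
  obtain s t where st: "0 < s" "s < t" and z: "Bessel_zero \<nu> 1 = 2 * sqrt s" "Bessel_zero (\<nu> + 1) 1 = 2 * sqrt t"
    and neg: "\<And>r. s < r \<Longrightarrow> r \<le> t \<Longrightarrow> clifford \<nu> r < 0"
    and pos: "\<And>r. 0 \<le> r \<Longrightarrow> r < t \<Longrightarrow> clifford (\<nu> + 1) r > 0" and t0: "clifford (\<nu> + 1) t = 0"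
    using clifford_consecutive_zeros[OF \<nu>] by metis
  \<comment> \<open>Beyond the first zero of \<open>J\<^sub>\<nu>\<^sub>+\<^sub>1\<close> nothing is gained, so the separation is capped there.\<close>
  define \<beta> where "\<beta> = min \<alpha> (2 * sqrt t / pi)"
  define R where "R = \<beta> / (2 * m)"
  have as: "\<alpha> > 2 * sqrt s / pi" using \<alpha> z(1) by (simp add: \<nu>_def)
  have bs: "\<beta> > 2 * sqrt s / pi" using as st by (simp add: \<beta>_def divide_strict_right_mono)
  have "2 * sqrt s / pi > 0" using st by simp
  then have \<beta>: "\<beta> > 0" using bs by linarith
  have R: "R > 0" using \<beta> m by (simp add: R_def)
  have cR: "pi\<^sup>2 * m\<^sup>2 * R\<^sup>2 = (pi * \<beta> / 2)\<^sup>2" using m by (simp add: R_def power_divide power_mult_distrib)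
  have "sqrt s < pi * \<beta> / 2" using bs by (simp add: field_simps)
  then have "(sqrt s)\<^sup>2 < (pi * \<beta> / 2)\<^sup>2" using st by (intro power_strict_mono) auto
  then have S: "s < pi\<^sup>2 * m\<^sup>2 * R\<^sup>2" using cR st by simp
  have "\<beta> \<le> 2 * sqrt t / pi" by (simp add: \<beta>_def)
  then have "pi * \<beta> / 2 \<le> sqrt t" by (simp add: field_simps)
  then have "(pi * \<beta> / 2)\<^sup>2 \<le> (sqrt t)\<^sup>2" using \<beta> by (intro power_mono) auto
  then have T: "pi\<^sup>2 * m\<^sup>2 * R\<^sup>2 \<le> t" using cR st by simp
  let ?F = "\<Sum>n\<in>int_lattice \<inter> cball 0 m. (cmod (\<Sum>i\<in>I. u i * char_exp n (p i)))\<^sup>2"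
  let ?U = "\<Sum>i\<in>I. (cmod (u i))\<^sup>2" and ?v = "unit_ball_vol (real CARD('n))" and ?d = "CARD('n)"
  have main: "?U \<le> profile_mass CARD('n) m R * ?F"
  proof (rule lattice_sum_ge[OF d m R _ _ S T I])
    fix i j k assume "i \<in> I" "j \<in> I" "i \<noteq> j" "k \<in> (int_lattice :: (real ^ 'n) set)"
    then have "norm (p i - p j + k) \<ge> \<alpha> / m" by (rule sep)
    moreover have "2 * R \<le> \<alpha> / m" using m by (simp add: R_def \<beta>_def divide_right_mono)
    ultimately show "norm (p i - p j + k) \<ge> 2 * R" by linarith
  qed (use neg pos in \<open>auto simp: \<nu>_def\<close>)
  have le: "c_const TYPE('n) \<alpha> * m ^ CARD('n) \<le> 1 / profile_mass CARD('n) m R" and mp: "profile_mass CARD('n) m R > 0"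
  proof -
    define x where "x = pi\<^sup>2 * m\<^sup>2 * R\<^sup>2"
    define f where "f = - clifford \<nu> x"
    define g where "g = clifford (\<nu> + 1) x"
    have f: "f > 0" using neg S T by (simp add: f_def x_def)
    have g: "g \<ge> 0" using pos[of x] t0 T by (cases "x = t") (auto simp: g_def x_def)
    have mass: "profile_mass CARD('n) m R = ?v * R ^ ?d * (1 + real ?d / 2 * g / f)"
      by (simp add: profile_mass_def f_def g_def x_def \<nu>_def)
    have pr: "1 + real ?d / 2 * g / f > 0" using f g by (intro add_pos_nonneg) auto
    show "profile_mass CARD('n) m R > 0"
      unfolding mass using R pr by (intro mult_pos_pos) auto
    show "c_const TYPE('n) \<alpha> * m ^ CARD('n) \<le> 1 / profile_mass CARD('n) m R"
    proof (cases "\<alpha> < 2 * sqrt t / pi")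
      case True
      then have \<beta>_eq: "\<beta> = \<alpha>" by (simp add: \<beta>_def)
      have \<alpha>0: "\<alpha> > 0" using \<beta> \<beta>_eq by simp
      have x: "x = (pi * \<alpha>)\<^sup>2 / 4" using cR \<beta>_eq by (simp add: x_def power_divide)
      have "pi * \<alpha> < 2 * sqrt t" using True by (simp add: field_simps)
      then have "(pi * \<alpha>)\<^sup>2 < (2 * sqrt t)\<^sup>2" using \<alpha>0 by (intro power_strict_mono) auto
      then have "x < t" using x st by (simp add: power_mult_distrib)
      then have g0: "g > 0" using pos[of x] by (simp add: g_def x_def)
      have \<gamma>: "gamma_const ?d \<alpha> = 2 * f / g"
      proof -
        have J0: "Bessel_J (real ?d / 2 - 1) (pi * \<alpha>) = (pi * \<alpha> / 2) powr \<nu> * (- f)"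
          using Bessel_J_eq_clifford[of "pi * \<alpha>" \<nu>] \<alpha>0 \<nu> by (simp add: \<nu>_def f_def x)
        have J1: "Bessel_J (real ?d / 2) (pi * \<alpha>) = (pi * \<alpha> / 2) powr \<nu> * (pi * \<alpha> / 2) * g"
          using Bessel_J_eq_clifford[of "pi * \<alpha>" "\<nu> + 1"] \<alpha>0 \<nu> by (simp add: \<nu>1 g_def x powr_add flip: \<nu>1)
        have "(pi * \<alpha> / 2) powr \<nu> > 0" using \<alpha>0 by simp
        then show ?thesis unfolding gamma_const_def J0 J1 using \<alpha>0 g0 by (simp add: field_simps)
      qed
      have "c_const TYPE('n) \<alpha> * m ^ ?d =
          1 / (real ?d * ?v) * (2 / \<alpha>) ^ ?d * (gamma_const ?d \<alpha> / (1 + gamma_const ?d \<alpha> / real ?d)) * m ^ ?d"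
        using True z(2) by (simp add: c_const_def Let_def sphere_measure_unit \<nu>1)
      also have "\<dots> = 1 / ?v * (2 * m / \<alpha>) ^ ?d * (gamma_const ?d \<alpha> / (1 + gamma_const ?d \<alpha> / real ?d) / real ?d)"
        by (simp add: power_divide power_mult_distrib mult_ac)
      also have "(2 * m / \<alpha>) ^ ?d = 1 / R ^ ?d"
        by (simp add: R_def \<beta>_eq power_divide)
      also have "gamma_const ?d \<alpha> / (1 + gamma_const ?d \<alpha> / real ?d) / real ?d = 1 / (1 + real ?d / 2 * g / f)"
      proof -
        have "real ?d > 0" by simp
        then show ?thesis
          unfolding \<gamma> using f g0 by (simp add: field_simps add_pos_pos less_imp_neq[symmetric])
      qed
      finally show ?thesis unfolding mass by simp
    next
      case False
      then have \<beta>_eq: "\<beta> = 2 * sqrt t / pi" by (simp add: \<beta>_def)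
      have "x = t" using cR \<beta>_eq st by (simp add: x_def)
      then have "g = 0" by (simp add: g_def t0)
      then have mass': "profile_mass CARD('n) m R = ?v * R ^ ?d" by (simp add: mass)
      have "c_const TYPE('n) \<alpha> * m ^ ?d = 1 / (real ?d * ?v) * (2 * pi / (2 * sqrt t)) ^ ?d * m ^ ?d"
        using False z(2) by (simp add: c_const_def Let_def sphere_measure_unit \<nu>1)
      also have "\<dots> = 1 / real ?d * (1 / (?v * R ^ ?d))"
        using m by (simp add: R_def \<beta>_eq power_divide power_mult_distrib field_simps)
      also have "\<dots> \<le> 1 * (1 / (?v * R ^ ?d))"
        using R by (intro mult_right_mono) auto
      finally show ?thesis unfolding mass' by simp
    qed
  qed
  have "c_const TYPE('n) \<alpha> * m ^ CARD('n) * ?U \<le> 1 / profile_mass CARD('n) m R * ?U"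
    using le by (intro mult_right_mono sum_nonneg) auto
  also have "\<dots> \<le> ?F" using main mp by (simp add: field_simps)
  finally show ?thesis .
qed

section \<open>From the lattice to the ball\<close>

lemma min_separation_le:
  assumes "min_separation f X \<ge> ereal r" "x \<in> X" "y \<in> X" "x \<noteq> y"
  shows "r \<le> f (x - y)"
proof -
  have "ereal r \<le> ereal (f (x - y))"
    using assms unfolding min_separation_def le_INF_iff by fastforce
  then show ?thesis by simp
qed

lemma torus_norm_le:
  assumes "k \<in> int_lattice"
  shows "torus_norm x \<le> norm (x + k)"
  unfolding torus_norm_def by (rule cINF_lower[OF _ assms]) (auto intro!: bdd_belowI[of _ 0])

lemma sum_unit_coeffs: "u \<in> unit_coeffs X \<Longrightarrow> (\<Sum>x\<in>X. (cmod (u x))\<^sup>2) = 1"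
  by (simp add: unit_coeffs_def L2_set_def)

lemma cmod_fourier_sum_le: "cmod (fourier_sum X u \<omega>) \<le> (\<Sum>x\<in>X. cmod (u x))"
  unfolding fourier_sum_def by (rule order_trans[OF norm_sum]) (simp add: norm_mult norm_char_exp)

text \<open>The integrand, cut off at the ball, is discontinuous at most on the bounding sphere, which is a null set.\<close>

lemma lattice_sum_tendsto_L2_norm:
  fixes X :: "(real ^ 'n) set"
  shows "(\<lambda>N. (1 / real N) ^ CARD('n) * (\<Sum>k\<in>int_lattice \<inter> cball 0 (real N * m).
      (cmod (fourier_sum X u ((1 / real N) *\<^sub>R k)))\<^sup>2)) \<longlonglongrightarrow> (L2_norm_on (cball 0 m) (fourier_sum X u))\<^sup>2"
proof -
  define g where "g \<omega> = (cmod (fourier_sum X u \<omega>))\<^sup>2" for \<omega>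
  define F where "F \<omega> = indicator (cball 0 m) \<omega> * g \<omega>" for \<omega> :: "real ^ 'n"
  have cg: "continuous_on A g" for A
    unfolding g_def fourier_sum_def char_exp_def by (intro continuous_intros)
  have lim: "(\<lambda>N. (1 / real N) ^ CARD('n) * (\<Sum>k\<in>int_lattice \<inter> cball 0 (real N * m). F ((1 / real N) *\<^sub>R k)))
      \<longlonglongrightarrow> (\<integral>\<omega>. F \<omega> \<partial>lborel)"
  proof (rule riemann_sum_tendsto[where C = "(\<Sum>x\<in>X. cmod (u x))\<^sup>2"])
    show "F \<in> borel_measurable lborel"
      unfolding F_def using borel_measurable_continuous_onI[OF cg]
      by (simp add: borel_measurable_indicator borel_measurable_times)
    show "norm \<omega> \<le> m" if "F \<omega> \<noteq> 0" for \<omega>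
      using that by (auto simp: F_def indicator_def split: if_splits)
    have "\<bar>g \<omega>\<bar> \<le> (\<Sum>x\<in>X. cmod (u x))\<^sup>2" for \<omega>
      unfolding g_def using power_mono[OF cmod_fourier_sum_le norm_ge_zero] by simp
    then show "\<bar>F \<omega>\<bar> \<le> (\<Sum>x\<in>X. cmod (u x))\<^sup>2" for \<omega>
      by (simp add: F_def indicator_def)
    have "sphere (0 :: real ^ 'n) m \<in> null_sets lborel"
      using negligible_sphere[of "0 :: real ^ 'n" m]
      by (auto simp: null_sets_completion_iff negligible_iff_null_sets)
    from AE_not_in[OF this] show "AE \<omega> in lborel. isCont F \<omega>"
    proof eventually_elim
      case (elim \<omega>)
      have "continuous_on (ball 0 m) F"
        by (rule continuous_on_eq[OF cg]) (simp add: F_def)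
      moreover have "continuous_on (- cball 0 m) F"
        by (rule continuous_on_eq[OF continuous_on_const[of _ 0]]) (simp add: F_def)
      moreover have "\<omega> \<in> ball 0 m \<or> \<omega> \<in> - cball 0 m" using elim by auto
      ultimately show ?case
        by (auto simp: continuous_on_eq_continuous_at open_Compl)
    qed
  qed
  have int: "(\<integral>\<omega>. F \<omega> \<partial>lborel) = (L2_norm_on (cball 0 m) (fourier_sum X u))\<^sup>2"
  proof -
    have "(\<integral>\<omega>. F \<omega> \<partial>lborel) \<ge> 0" by (intro Bochner_Integration.integral_nonneg) (simp add: F_def g_def)
    then show ?thesis by (simp add: L2_norm_on_def set_lebesgue_integral_def F_def g_def)
  qed
  have eqN: "(\<Sum>k\<in>int_lattice \<inter> cball 0 (real N * m). F ((1 / real N) *\<^sub>R k)) =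
      (\<Sum>k\<in>int_lattice \<inter> cball 0 (real N * m). (cmod (fourier_sum X u ((1 / real N) *\<^sub>R k)))\<^sup>2)" if "N > 0" for N
  proof (rule sum.cong)
    fix k :: "real ^ 'n" assume "k \<in> int_lattice \<inter> cball 0 (real N * m)"
    then have "norm k / real N \<le> m" using that by (simp add: field_simps)
    then show "F ((1 / real N) *\<^sub>R k) = (cmod (fourier_sum X u ((1 / real N) *\<^sub>R k)))\<^sup>2"
      by (simp add: F_def g_def)
  qed simp
  have "\<forall>\<^sub>F N in sequentially. (1 / real N) ^ CARD('n) * (\<Sum>k\<in>int_lattice \<inter> cball 0 (real N * m). F ((1 / real N) *\<^sub>R k)) =
      (1 / real N) ^ CARD('n) * (\<Sum>k\<in>int_lattice \<inter> cball 0 (real N * m). (cmod (fourier_sum X u ((1 / real N) *\<^sub>R k)))\<^sup>2)"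
    using eventually_gt_at_top[of 0]
  proof eventually_elim
    case (elim N)
    show ?case by (simp only: eqN[OF elim])
  qed
  from Lim_transform_eventually[OF lim this] show ?thesis unfolding int .
qed

theorem theorem2p5:
  fixes X :: "(real ^ 'n) set" and m \<alpha> :: real
  assumes "CARD('n) \<ge> 2"
    and "m > 0"
    and "\<alpha> > Bessel_zero (real CARD('n) / 2 - 1) 1 / pi"
    and "finite X" and "X \<noteq> {}"
    and "X \<subseteq> {x. \<forall>i. - 1 / 2 \<le> x $ i \<and> x $ i < 1 / 2}"
  shows "(min_separation norm X \<ge> ereal (\<alpha> / m) \<longrightarrow>
            sigma_min_F (cball 0 m) X \<ge> sqrt (c_const TYPE('n) \<alpha> * m ^ CARD('n))) \<and>
         (min_separation torus_norm X \<ge> ereal (\<alpha> / m) \<longrightarrow>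
            sigma_min_Phi (cball 0 m) X \<ge> sqrt (c_const TYPE('n) \<alpha> * m ^ CARD('n)))"
proof (intro conjI impI)
  assume sep: "min_separation norm X \<ge> ereal (\<alpha> / m)"
  obtain u where u: "u \<in> unit_coeffs X" and eq: "L2_norm_on (cball 0 m) (fourier_sum X u) = sigma_min_F (cball 0 m) X"
    using sigma_min_F_attained[OF compact_cball assms(4,5)] by blast
  obtain D where D: "\<And>x. x \<in> X \<Longrightarrow> norm x \<le> D"
    using finite_imp_bounded[OF assms(4)] by (auto simp: bounded_iff)
  \<comment> \<open>For large \<open>N\<close> the nodes \<open>x / N\<close> are close to each other and far from their nonzero integer translates.\<close>
  have dilated: "c_const TYPE('n) \<alpha> * m ^ CARD('n) \<le> (1 / real N) ^ CARD('n) *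
      (\<Sum>k\<in>int_lattice \<inter> cball 0 (real N * m). (cmod (fourier_sum X u ((1 / real N) *\<^sub>R k)))\<^sup>2)"
    if "N > 0" and large: "real N \<ge> 2 * D + \<alpha> / m" for N
  proof -
    have N: "real N > 0" using that by simp
    have sepN: "norm ((1 / real N) *\<^sub>R x - (1 / real N) *\<^sub>R y + k) \<ge> \<alpha> / (real N * m)"
      if xy: "x \<in> X" "y \<in> X" "x \<noteq> y" and k: "k \<in> int_lattice" for x y k
    proof -
      have "\<alpha> / m \<le> norm (x - y + real N *\<^sub>R k)"
      proof (cases "k = 0")
        case True
        then show ?thesis using min_separation_le[OF sep xy] by simp
      next
        case False
        have "real N \<le> norm (real N *\<^sub>R k)" using norm_int_lattice_ge_1[OF k False] by (simp add: mult_le_cancel_left1)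
        moreover have "norm (x - y) \<le> 2 * D" using norm_triangle_ineq4[of x y] D[OF xy(1)] D[OF xy(2)] by simp
        ultimately show ?thesis
          using large norm_triangle_ineq4[of "x - y + real N *\<^sub>R k" "x - y"] by simp
      qed
      also have "x - y + real N *\<^sub>R k = real N *\<^sub>R ((1 / real N) *\<^sub>R x - (1 / real N) *\<^sub>R y + k)"
        using N by (simp add: scaleR_add_right scaleR_diff_right)
      finally have "\<alpha> / m \<le> real N * norm ((1 / real N) *\<^sub>R x - (1 / real N) *\<^sub>R y + k)"
        by (simp only: norm_scaleR abs_of_nat)
      then have "(1 / real N) * (\<alpha> / m) \<le>
          (1 / real N) * (real N * norm ((1 / real N) *\<^sub>R x - (1 / real N) *\<^sub>R y + k))"
        by (rule mult_left_mono) simp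
      also have "\<dots> = norm ((1 / real N) *\<^sub>R x - (1 / real N) *\<^sub>R y + k)"
        unfolding mult.assoc[symmetric] using N by simp
      finally show ?thesis by simp
    qed
    have "c_const TYPE('n) \<alpha> * (real N * m) ^ CARD('n) * (\<Sum>x\<in>X. (cmod (u x))\<^sup>2) \<le>
      (\<Sum>k\<in>int_lattice \<inter> cball 0 (real N * m). (cmod (\<Sum>x\<in>X. u x * char_exp k ((1 / real N) *\<^sub>R x)))\<^sup>2)"
      by (rule lattice_sum_ge_c_const[OF assms(1) _ assms(3,4) sepN]) (use N assms(2) in auto)
    moreover have "char_exp k ((1 / real N) *\<^sub>R x) = char_exp ((1 / real N) *\<^sub>R k) x" for k x :: "real ^ 'n"
      by (simp add: char_exp_def)
    ultimately have "c_const TYPE('n) \<alpha> * (real N * m) ^ CARD('n) \<le>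
      (\<Sum>k\<in>int_lattice \<inter> cball 0 (real N * m). (cmod (fourier_sum X u ((1 / real N) *\<^sub>R k)))\<^sup>2)"
      by (simp add: sum_unit_coeffs[OF u] fourier_sum_def)
    then have "(1 / real N) ^ CARD('n) * (c_const TYPE('n) \<alpha> * (real N * m) ^ CARD('n)) \<le> (1 / real N) ^ CARD('n) *
      (\<Sum>k\<in>int_lattice \<inter> cball 0 (real N * m). (cmod (fourier_sum X u ((1 / real N) *\<^sub>R k)))\<^sup>2)"
      by (rule mult_left_mono) simp
    then show ?thesis using N by (simp add: power_mult_distrib power_divide)
  qed
  have "\<forall>\<^sub>F N in sequentially. c_const TYPE('n) \<alpha> * m ^ CARD('n) \<le> (1 / real N) ^ CARD('n) *
      (\<Sum>k\<in>int_lattice \<inter> cball 0 (real N * m). (cmod (fourier_sum X u ((1 / real N) *\<^sub>R k)))\<^sup>2)"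
    using eventually_gt_at_top[of 0] eventually_ge_at_top[of "nat \<lceil>2 * D + \<alpha> / m\<rceil>"]
  proof eventually_elim
    case (elim N)
    then show ?case by (intro dilated) (simp_all add: nat_le_iff ceiling_le_iff)
  qed
  then have "c_const TYPE('n) \<alpha> * m ^ CARD('n) \<le> (L2_norm_on (cball 0 m) (fourier_sum X u))\<^sup>2"
    by (intro tendsto_lowerbound[OF lattice_sum_tendsto_L2_norm]) auto
  moreover have "L2_norm_on (cball 0 m) (fourier_sum X u) \<ge> 0"
    unfolding L2_norm_on_def set_lebesgue_integral_def
    by (intro real_sqrt_ge_zero Bochner_Integration.integral_nonneg) (simp add: indicator_def)
  ultimately show "sigma_min_F (cball 0 m) X \<ge> sqrt (c_const TYPE('n) \<alpha> * m ^ CARD('n))"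
    unfolding eq by (intro real_le_lsqrt)
next
  assume sep: "min_separation torus_norm X \<ge> ereal (\<alpha> / m)"
  obtain u where u: "u \<in> unit_coeffs X" and eq: "L2_set (\<lambda>\<omega>. cmod (fourier_sum X u \<omega>)) (cball 0 m \<inter> int_lattice) =
      sigma_min_Phi (cball 0 m) X"
    using sigma_min_Phi_attained[OF assms(4,5)] by blast
  have "c_const TYPE('n) \<alpha> * m ^ CARD('n) * (\<Sum>x\<in>X. (cmod (u x))\<^sup>2) \<le>
      (\<Sum>n\<in>int_lattice \<inter> cball 0 m. (cmod (\<Sum>x\<in>X. u x * char_exp n x))\<^sup>2)"
  proof (rule lattice_sum_ge_c_const[OF assms(1-4)])
    fix x y k assume "x \<in> X" "y \<in> X" "x \<noteq> y" "k \<in> (int_lattice :: (real ^ 'n) set)"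
    then show "\<alpha> / m \<le> norm (x - y + k)"
      using min_separation_le[OF sep] torus_norm_le order_trans by metis
  qed
  then show "sigma_min_Phi (cball 0 m) X \<ge> sqrt (c_const TYPE('n) \<alpha> * m ^ CARD('n))"
    unfolding eq[symmetric] L2_set_def
    by (simp add: sum_unit_coeffs[OF u] fourier_sum_def Int_commute)
qed

end
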